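(* Let $f=a+b$ on $W=\mathbb{R}^p$, where $a:\mathbb{R}^p\to\mathbb{R}$ is $\alpha$-strongly convex ($\alpha>0$) and $L$-smooth, and $b:\mathbb{R}^p\to\mathbb{R}$ is continuous and convex. Let $w^*$ be the minimizer of $f$. Let $\beta=1/4$, $\epsilon\in(0,1)$, $v_0\in W$, backtracking parameter $\eta\in(1,\infty)$, initial smoothness estimate $\ell_0^0\in(0,L]$, and $\bar\kappa:=L\eta/\alpha$. Let $\{v_i\}$, $\{\tau_i\}$ be generated by adaptively restarted AGD (defined in the context) from $v_0$ with parameter $\beta$ and arbitrary initial epoch length $\tau_1\in\mathbb{N}$. Then at most $$8.5\left(\sqrt{\bar\kappa}+1\right)\ln\!\left(\frac8\epsilon\right)+\max\left\{26\sqrt{\bar\kappa}\,\ln\!\left(\frac{12\sqrt{\bar\kappa}}{\tau_1}\right),\ 2\tau_1\right\}$$ AGD steps are required until some $v_n$ satisfies $\|w^*-v_n\|_2\le\epsilon\|w^*-v_0\|_2$; that is, there is $n\in\mathbb{N}$ with $\|w^*-v_n\|_2\le\epsilon\|w^*-v_0\|_2$ and $\sum_{i=1}^n\tau_i$ at most the displayed quantity.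
   Context: $\mathbb{N}=\{1,2,\dots\}$. A function $a$ is $\alpha$-strongly convex if $\lambda_{\min}(\nabla^2a(x))\ge\alpha$ for all $x$, and $L$-smooth if it is differentiable with $\|\nabla a(w)-\nabla a(w')\|_2\le L\|w-w'\|_2$ for all $w,w'$. For $\ell>0$ let $p_\ell(y)=\arg\min_{x\in\mathbb{R}^p}\nabla a(y)^T(x-y)+b(x)+\frac\ell2\|x-y\|_2^2$. AGD (FISTA with backtracking) from $v\in\mathbb{R}^p$: set $w^0=z^0=v$, $\lambda^0=1$, $\ell^0=\ell_0^0$. For $t=1,2,\dots$: let $k$ be the smallest nonnegative integer such that with $\bar\ell=\eta^k\ell^{t-1}$ and $p=p_{\bar\ell}(z^{t-1})$, $$f(p)\le a(z^{t-1})+(p-z^{t-1})^T\nabla a(z^{t-1})+\tfrac{\bar\ell}{2}\|p-z^{t-1}\|_2^2+b(p);$$ set $\ell^t=\eta^k\ell^{t-1}$, $w^t=p_{\ell^t}(z^{t-1})$, $\lambda^t=\frac{1+\sqrt{1+4(\lambda^{t-1})^2}}{2}$, $z^t=w^t+\frac{\lambda^{t-1}-1}{\lambda^t}(w^t-w^{t-1})$. The output at step $t$ is $w^t=w^t(v)$. Adaptively restarted AGD with parameter $\beta$: given $v_0$, for epochs $i=1,2,\dots$ run AGD from $v_{i-1}$, producing $w_i^t=w^t(v_{i-1})$. Epoch $1$ is stopped after an arbitrarily chosen number $\tau_1\in\mathbb{N}$ of steps. For $i>1$, epoch $i$ is stopped at the first $t\in\mathbb{N}$ (called $\tau_i$)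 with $$\frac{\|w_i^t-v_{i-1}\|_2}{(t+1)^2}\le\beta\,\frac{\|v_{i-1}-v_{i-2}\|_2}{(\tau_{i-1}+1)^2}.$$ Set $v_i=w_i^{\tau_i}$. *)

theory Defs
  imports "HOL-Analysis.Analysis"
begin

definition gradient :: "(real ^ 'p \<Rightarrow> real) \<Rightarrow> real ^ 'p \<Rightarrow> real ^ 'p" where
  "gradient a x = (THE D. GDERIV a x :> D)"

definition hessian :: "(real ^ 'p \<Rightarrow> real) \<Rightarrow> real ^ 'p \<Rightarrow> real ^ 'p ^ 'p" where
  "hessian a x = jacobian (gradient a) (at x)"

definition eigenvalues :: "real ^ 'p ^ 'p \<Rightarrow> real set" where
  "eigenvalues A = {\<mu>. \<exists>v. v \<noteq> 0 \<and> A *v v = \<mu> *\<^sub>R v}"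

text \<open>Only applied to Hessians of twice differentiable functions; these are symmetric, so
  the set of real eigenvalues is finite and nonempty.\<close>

definition lambda_min :: "real ^ 'p ^ 'p \<Rightarrow> real" where
  "lambda_min A = Min (eigenvalues A)"

definition strongly_convex :: "real \<Rightarrow> (real ^ 'p \<Rightarrow> real) \<Rightarrow> bool" where
  "strongly_convex \<alpha> a \<longleftrightarrow>
     (\<forall>x. a differentiable (at x)) \<and>
     (\<forall>x. gradient a differentiable (at x)) \<and>
     (\<forall>x. lambda_min (hessian a x) \<ge> \<alpha>)"

definition smooth :: "real \<Rightarrow> (real ^ 'p \<Rightarrow> real) \<Rightarrow> bool" where
  "smooth L a \<longleftrightarrow>
     (\<forall>x. a differentiable (at x)) \<and>
     (\<forall>w w'. norm (gradient a w - gradient a w') \<le> L * norm (w - w'))"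

definition prox_step ::
  "(real ^ 'p \<Rightarrow> real) \<Rightarrow> (real ^ 'p \<Rightarrow> real) \<Rightarrow> real \<Rightarrow> real ^ 'p \<Rightarrow> real ^ 'p" where
  "prox_step a b l y =
     arg_min (\<lambda>x. gradient a y \<bullet> (x - y) + b x + l / 2 * (norm (x - y))\<^sup>2) (\<lambda>_. True)"

definition sufficient_decrease ::
  "(real ^ 'p \<Rightarrow> real) \<Rightarrow> (real ^ 'p \<Rightarrow> real) \<Rightarrow> real \<Rightarrow> real ^ 'p \<Rightarrow> bool" where
  "sufficient_decrease a b l z \<longleftrightarrow>
     (let p = prox_step a b l z
      in a p + b p \<le> a z + (p - z) \<bullet> gradient a z + l / 2 * (norm (p - z))\<^sup>2 + b p)"

definition backtrack ::
  "(real ^ 'p \<Rightarrow> real) \<Rightarrow> (real ^ 'p \<Rightarrow> real) \<Rightarrow> real \<Rightarrow> real \<Rightarrow> real ^ 'p \<Rightarrow> real" where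
  "backtrack a b \<eta> l z = \<eta> ^ (LEAST k. sufficient_decrease a b (\<eta> ^ k * l) z) * l"

text \<open>The state after \<open>t\<close> steps of AGD started at \<open>v\<close> is
  \<open>(w\<^sup>t, z\<^sup>t, \<lambda>\<^sup>t, \<ell>\<^sup>t)\<close>.\<close>

primrec agd_state ::
  "(real ^ 'p \<Rightarrow> real) \<Rightarrow> (real ^ 'p \<Rightarrow> real) \<Rightarrow> real \<Rightarrow> real \<Rightarrow> real ^ 'p \<Rightarrow> nat \<Rightarrow>
     (real ^ 'p) \<times> (real ^ 'p) \<times> real \<times> real" where
  "agd_state a b \<eta> l0 v 0 = (v, v, 1, l0)"
| "agd_state a b \<eta> l0 v (Suc t) =
     (let (w, z, lam, l) = agd_state a b \<eta> l0 v t;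
          l' = backtrack a b \<eta> l z;
          w' = prox_step a b l' z;
          lam' = (1 + sqrt (1 + 4 * lam\<^sup>2)) / 2;
          z' = w' + ((lam - 1) / lam') *\<^sub>R (w' - w)
      in (w', z', lam', l'))"

definition agd ::
  "(real ^ 'p \<Rightarrow> real) \<Rightarrow> (real ^ 'p \<Rightarrow> real) \<Rightarrow> real \<Rightarrow> real \<Rightarrow> real ^ 'p \<Rightarrow> nat \<Rightarrow> real ^ 'p" where
  "agd a b \<eta> l0 v t = fst (agd_state a b \<eta> l0 v t)"

text \<open>The stopping test of epoch \<open>i > 1\<close> after \<open>t\<close> steps; it depends on the
  preceding epochs only.\<close>

definition stop_test ::
  "(real ^ 'p \<Rightarrow> real) \<Rightarrow> (real ^ 'p \<Rightarrow> real) \<Rightarrow> real \<Rightarrow> real \<Rightarrow> real \<Rightarrow>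
     (nat \<Rightarrow> real ^ 'p) \<Rightarrow> (nat \<Rightarrow> nat) \<Rightarrow> nat \<Rightarrow> nat \<Rightarrow> bool" where
  "stop_test a b \<eta> l0 \<beta> v \<tau> i t \<longleftrightarrow>
     norm (agd a b \<eta> l0 (v (i - 1)) t - v (i - 1)) / (real t + 1)\<^sup>2
       \<le> \<beta> * (norm (v (i - 1) - v (i - 2)) / (real (\<tau> (i - 1)) + 1)\<^sup>2)"

definition epoch_terminates ::
  "(real ^ 'p \<Rightarrow> real) \<Rightarrow> (real ^ 'p \<Rightarrow> real) \<Rightarrow> real \<Rightarrow> real \<Rightarrow> real \<Rightarrow>
     (nat \<Rightarrow> real ^ 'p) \<Rightarrow> (nat \<Rightarrow> nat) \<Rightarrow> nat \<Rightarrow> bool" where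
  "epoch_terminates a b \<eta> l0 \<beta> v \<tau> i \<longleftrightarrow>
     i = 1 \<or> (\<exists>t\<ge>1. stop_test a b \<eta> l0 \<beta> v \<tau> i t)"

text \<open>\<open>v i\<close> and \<open>\<tau> i\<close> describe the algorithm only as long as all epochs up to \<open>i\<close>
  terminate: if epoch \<open>i\<close> does not, \<open>\<tau> i\<close> is an unspecified number. Hence any claim
  about \<open>v n\<close> must be accompanied by \<^const>\<open>epoch_terminates\<close> for the epochs up to \<open>n\<close>.
  The value \<open>\<tau> 0\<close> is irrelevant.\<close>

definition restarted_agd ::
  "(real ^ 'p \<Rightarrow> real) \<Rightarrow> (real ^ 'p \<Rightarrow> real) \<Rightarrow> real \<Rightarrow> real \<Rightarrow> real \<Rightarrow>
     (nat \<Rightarrow> real ^ 'p) \<Rightarrow> (nat \<Rightarrow> nat) \<Rightarrow> bool" where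
  "restarted_agd a b \<eta> l0 \<beta> v \<tau> \<longleftrightarrow>
     \<tau> 1 \<ge> 1 \<and>
     (\<forall>i>1. \<tau> i = (LEAST t. t \<ge> 1 \<and> stop_test a b \<eta> l0 \<beta> v \<tau> i t)) \<and>
     (\<forall>i\<ge>1. v i = agd a b \<eta> l0 (v (i - 1)) (\<tau> i))"

end

theory Submission
  imports Defs
begin

text \<open>
  Let \<open>R = \<parallel>v - w*\<parallel>\<close>, \<open>W = \<parallel>w\<^sup>t - w*\<parallel>\<close> and \<open>X = (t + 1) / (2 \<surd>\<kappa>)\<close>. The FISTA energy estimate and
  strong convexity give \<open>X W \<le> R\<close>; since \<open>w\<^sup>t\<close> is a convex combination of the previous iterate and the point
  whose distance to \<open>w*\<close> enters the energy, an induction also gives \<open>(1 + X\<^sup>2/2) W\<^sup>2 \<le> R\<^sup>2\<close>. Together they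
  bound the displacement from below: \<open>X\<^sup>2 W \<le> (X + 4) \<parallel>w\<^sup>t - v\<parallel>\<close>.

  Hence an epoch of normalised length \<open>X\<close> divides the error by at least \<open>max {1, X}\<close>, and the quotient
  tested by the stopping rule is at least of the order of the error times \<open>1 / (X + 4)\<close>. As this quotient drops
  by a factor 4 in every epoch, the number of epochs is logarithmic; and as the test fails one step
  before an epoch ends, a length above 8 is bounded by the square root of the previous one. Charging the length of
  an epoch to the logarithmic decrease of the error (weight 7), to the epoch count (\<open>3 ln 2\<close>) and to
  the excess of the previous length over 8 yields the bound.
\<close>

subsection \<open>Strongly convex and smooth functions\<close>

lemma gradient_has_derivative:
  fixes a :: "real ^ 'p \<Rightarrow> real"
  assumes "a differentiable (at x)"
  shows "(a has_derivative (\<lambda>h. h \<bullet> gradient a x)) (at x)"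
proof -
  obtain a' where a': "(a has_derivative a') (at x)"
    using assms by (auto simp: differentiable_def)
  then have "linear a'" by (rule has_derivative_linear)
  \<comment> \<open>The vector representing the functional \<open>a'\<close> is its adjoint applied
    to \<open>1\<close>.\<close>
  then have "a' h = h \<bullet> adjoint a' 1" for h
    using adjoint_works[of a' h 1] by simp
  then have "a' = (\<lambda>h. h \<bullet> adjoint a' 1)" by auto
  then have ex: "GDERIV a x :> adjoint a' 1"
    using a' by (simp add: gderiv_def)
  have "D = D'" if "GDERIV a x :> D" "GDERIV a x :> D'" for D D'
    using has_derivative_unique[OF that[unfolded gderiv_def]]
    by (metis vector_eq_ldot)
  then have "GDERIV a x :> gradient a x"
    unfolding gradient_def using ex by (rule_tac theI) auto
  then show ?thesis by (simp add: gderiv_def)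
qed

lemma has_derivative_along_line:
  fixes a :: "'a::real_inner \<Rightarrow> real"
  assumes "(a has_derivative (\<lambda>h. h \<bullet> g)) (at (x + s *\<^sub>R d))"
  shows "((\<lambda>s. a (x + s *\<^sub>R d)) has_real_derivative (d \<bullet> g)) (at s)"
proof -
  have "((\<lambda>s. x + s *\<^sub>R d) has_derivative (\<lambda>h. h *\<^sub>R d)) (at s)"
    by (auto intro!: derivative_eq_intros)
  from has_derivative_compose[OF this assms] show ?thesis
    by (simp add: has_field_derivative_def mult_commute_abs)
qed

text \<open>The mean value theorem turns the mixed second difference into \<open>t\<close> times the
  inner product of \<open>u\<close> with a difference of gradients. Both gradients are expanded
  around \<open>x\<close>, as the Hessian is not known to be continuous.\<close>

lemma second_difference_bound:
  fixes a :: "'a::real_inner \<Rightarrow> real"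
  assumes a: "\<And>y. (a has_derivative (\<lambda>h. h \<bullet> g y)) (at y)"
    and lin: "linear A"
    and rem: "\<And>y. norm (y - x) < r \<Longrightarrow> norm (g y - g x - A (y - x)) \<le> c * norm (y - x)"
    and "0 \<le> c" "0 < t" "t * (norm u + norm v) < r"
  shows "\<bar>a (x + t *\<^sub>R u + t *\<^sub>R v) - a (x + t *\<^sub>R u) - a (x + t *\<^sub>R v) + a x - t\<^sup>2 * (A v \<bullet> u)\<bar>
           \<le> c * (2 * (norm u + norm v)\<^sup>2) * t\<^sup>2"
proof -
  define N where "N = norm u + norm v"
  have N: "norm u \<le> N" "0 \<le> N" by (auto simp: N_def)
  define \<phi> where "\<phi> = (\<lambda>\<sigma>. a ((x + t *\<^sub>R v) + \<sigma> *\<^sub>R u) - a (x + \<sigma> *\<^sub>R u))"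
  have "(\<phi> has_real_derivative (u \<bullet> g ((x + t *\<^sub>R v) + \<sigma> *\<^sub>R u) - u \<bullet> g (x + \<sigma> *\<^sub>R u))) (at \<sigma>)" for \<sigma>
    unfolding \<phi>_def by (intro DERIV_diff has_derivative_along_line a)
  from MVT2[OF \<open>0 < t\<close> this] obtain \<xi> where \<xi>: "0 < \<xi>" "\<xi> < t"
    and eq: "\<phi> t - \<phi> 0 = t * (u \<bullet> (g ((x + t *\<^sub>R v) + \<xi> *\<^sub>R u) - g (x + \<xi> *\<^sub>R u)))"
    by (auto simp: inner_diff_right)
  define y1 where "y1 = (x + t *\<^sub>R v) + \<xi> *\<^sub>R u"
  define y2 where "y2 = x + \<xi> *\<^sub>R u"
  have xu: "\<xi> * norm u \<le> t * norm u" using \<xi> by (simp add: mult_right_mono)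
  have "norm (y1 - x) \<le> norm (t *\<^sub>R v) + norm (\<xi> *\<^sub>R u)"
    unfolding y1_def by (metis add.assoc add_diff_cancel_left' norm_triangle_ineq)
  then have n1: "norm (y1 - x) \<le> t * N"
    using xu \<xi> \<open>0 < t\<close> by (simp add: N_def algebra_simps)
  have n2: "norm (y2 - x) \<le> t * N"
    using xu \<xi> \<open>0 < t\<close> by (simp add: y2_def N_def algebra_simps add_increasing2)
  define R where "R = (\<lambda>y. g y - g x - A (y - x))"
  have bR: "norm (R y) \<le> c * (t * N)" if "norm (y - x) \<le> t * N" for y
  proof -
    have "norm (R y) \<le> c * norm (y - x)"
      unfolding R_def using that assms(6) by (intro rem) (simp add: N_def)
    also have "\<dots> \<le> c * (t * N)" using that \<open>0 \<le> c\<close> by (rule mult_left_mono)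
    finally show ?thesis .
  qed
  have "g y1 - g y2 = R y1 - R y2 + A ((y1 - x) - (y2 - x))"
    by (simp only: R_def linear_diff[OF lin, of "y1 - x" "y2 - x"]) simp
  also have "(y1 - x) - (y2 - x) = t *\<^sub>R v" by (simp add: y1_def y2_def)
  finally have gd: "g y1 - g y2 = R y1 - R y2 + t *\<^sub>R A v"
    by (simp add: linear_scale[OF lin])
  have "norm (R y1 - R y2) \<le> 2 * (c * (t * N))"
    using norm_triangle_ineq4[of "R y1" "R y2"] bR[OF n1] bR[OF n2] by simp
  then have "\<bar>u \<bullet> (R y1 - R y2)\<bar> \<le> N * (2 * (c * (t * N)))"
    by (meson Cauchy_Schwarz_ineq2 N mult_mono norm_ge_zero order_trans)
  then have bnd: "t * \<bar>u \<bullet> (R y1 - R y2)\<bar> \<le> t * (N * (2 * (c * (t * N))))"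
    using \<open>0 < t\<close> by (intro mult_left_mono) auto
  have "\<phi> t - \<phi> 0 - t\<^sup>2 * (A v \<bullet> u) = t * (u \<bullet> (R y1 - R y2))"
    using eq unfolding y1_def[symmetric] y2_def[symmetric] gd
    by (simp add: inner_add_right inner_commute power2_eq_square algebra_simps)
  then have "\<bar>\<phi> t - \<phi> 0 - t\<^sup>2 * (A v \<bullet> u)\<bar> \<le> t * (N * (2 * (c * (t * N))))"
    using bnd \<open>0 < t\<close> by (simp add: abs_mult)
  then show ?thesis
    by (simp add: \<phi>_def N_def power2_eq_square algebra_simps)
qed

text \<open>The mixed second difference is symmetric in \<open>u\<close> and \<open>v\<close>, yet
  it approximates both \<open>t\<^sup>2 * (A v \<bullet> u)\<close> and
  \<open>t\<^sup>2 * (A u \<bullet> v)\<close> up to a small multiple of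
  \<open>t\<^sup>2\<close>.\<close>

lemma second_derivative_symmetric:
  fixes a :: "'a::real_inner \<Rightarrow> real"
  assumes a: "\<And>y. (a has_derivative (\<lambda>h. h \<bullet> g y)) (at y)"
    and g: "(g has_derivative A) (at x)"
  shows "A u \<bullet> v = u \<bullet> A v"
proof -
  have lin: "linear A" using g by (rule has_derivative_linear)
  define N where "N = norm u + norm v"
  have "\<bar>A v \<bullet> u - A u \<bullet> v\<bar> \<le> 0 + e" if "e > 0" for e
  proof -
    \<comment> \<open>The two approximation errors add up to \<open>c * (4 * N\<^sup>2)\<close>
      times \<open>t\<^sup>2\<close>; the \<open>+ 1\<close> covers \<open>N = 0\<close>.\<close>
    define c where "c = e / (4 * N\<^sup>2 + 1)"
    have N4: "4 * N\<^sup>2 + 1 > 0" by (simp add: add_nonneg_pos)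
    have c: "c > 0" using that N4 by (simp add: c_def)
    obtain r where "r > 0" and r: "\<And>y. norm (y - x) < r \<Longrightarrow> norm (g y - g x - A (y - x)) \<le> c * norm (y - x)"
      using g c unfolding has_derivative_at_alt by blast
    define t where "t = r / (N + 1)"
    have N: "0 \<le> N" by (simp add: N_def)
    have t: "t > 0" using \<open>r > 0\<close> N by (simp add: t_def)
    have "t * (N + 1) = r" using N by (simp add: t_def)
    then have tr: "t * N < r" using t by (simp add: algebra_simps)
    define \<Delta> where "\<Delta> = a (x + t *\<^sub>R u + t *\<^sub>R v) - a (x + t *\<^sub>R u) - a (x + t *\<^sub>R v) + a x"
    have 1: "\<bar>\<Delta> - t\<^sup>2 * (A v \<bullet> u)\<bar> \<le> c * (2 * N\<^sup>2) * t\<^sup>2"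
      unfolding \<Delta>_def N_def
      by (rule second_difference_bound[OF a lin r]) (use c t tr in \<open>auto simp: N_def\<close>)
    have "\<bar>a (x + t *\<^sub>R v + t *\<^sub>R u) - a (x + t *\<^sub>R v) - a (x + t *\<^sub>R u) + a x - t\<^sup>2 * (A u \<bullet> v)\<bar>
           \<le> c * (2 * (norm v + norm u)\<^sup>2) * t\<^sup>2"
      by (rule second_difference_bound[OF a lin r]) (use c t tr in \<open>auto simp: N_def add.commute\<close>)
    then have 2: "\<bar>\<Delta> - t\<^sup>2 * (A u \<bullet> v)\<bar> \<le> c * (2 * N\<^sup>2) * t\<^sup>2"
      by (simp add: \<Delta>_def N_def algebra_simps)
    have "t\<^sup>2 * \<bar>A v \<bullet> u - A u \<bullet> v\<bar> = \<bar>t\<^sup>2 * (A v \<bullet> u) - t\<^sup>2 * (A u \<bullet> v)\<bar>"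
      by (simp add: abs_mult flip: right_diff_distrib)
    also have "\<dots> \<le> t\<^sup>2 * (c * (4 * N\<^sup>2))"
      using 1 2 by (simp add: algebra_simps)
    finally have "\<bar>A v \<bullet> u - A u \<bullet> v\<bar> \<le> c * (4 * N\<^sup>2)"
      using t by (simp add: mult_le_cancel_left_pos)
    also have "\<dots> \<le> c * (4 * N\<^sup>2 + 1)" using c by simp
    also have "\<dots> = e" using N4 by (simp add: c_def)
    finally show ?thesis by simp
  qed
  then have "\<bar>A v \<bullet> u - A u \<bullet> v\<bar> \<le> 0" by (rule field_le_epsilon)
  then show ?thesis by (simp add: inner_commute)
qed

text \<open>Eigenvectors of distinct eigenvalues are orthogonal, hence independent. Finiteness lets
  \<open>Min_le\<close> apply to \<open>lambda_min\<close>.\<close>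

lemma finite_eigenvalues_symmetric:
  fixes A :: "real ^ 'p ^ 'p"
  assumes sym: "\<And>u v. (A *v u) \<bullet> v = u \<bullet> (A *v v)"
  shows "finite (eigenvalues A)"
proof -
  have "\<forall>\<mu>\<in>eigenvalues A. \<exists>v. v \<noteq> 0 \<and> A *v v = \<mu> *\<^sub>R v"
    by (simp add: eigenvalues_def)
  then obtain x where x: "\<And>\<mu>. \<mu> \<in> eigenvalues A \<Longrightarrow> x \<mu> \<noteq> 0 \<and> A *v x \<mu> = \<mu> *\<^sub>R x \<mu>"
    by (metis (lifting))
  have orth: "x \<mu> \<bullet> x \<nu> = 0" if "\<mu> \<in> eigenvalues A" "\<nu> \<in> eigenvalues A" "\<mu> \<noteq> \<nu>" for \<mu> \<nu>
    using sym[of "x \<mu>" "x \<nu>"] x[OF that(1)] x[OF that(2)] that(3) by simp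
  have inj: "inj_on x (eigenvalues A)"
    using orth x by (intro inj_onI) (metis inner_eq_zero_iff)
  have "pairwise orthogonal (x ` eigenvalues A)"
    using orth by (auto simp: pairwise_def orthogonal_def)
  moreover have "0 \<notin> x ` eigenvalues A" using x by auto
  ultimately have "finite (x ` eigenvalues A)"
    using pairwise_orthogonal_independent independent_imp_finite by blast
  then show ?thesis using inj by (rule finite_imageD)
qed

text \<open>The form attains its minimum \<open>m\<close> over the unit sphere, and the first
  variation makes the minimizer an eigenvector, so \<open>m\<close> is an eigenvalue.\<close>

lemma lambda_min_le_quadratic_form:
  fixes A :: "real ^ 'p ^ 'p"
  assumes sym: "\<And>u v. (A *v u) \<bullet> v = u \<bullet> (A *v v)"
  shows "lambda_min A * (norm x)\<^sup>2 \<le> x \<bullet> (A *v x)"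
proof -
  have "sphere (0 :: real ^ 'p) 1 \<noteq> {}" by simp
  moreover have "continuous_on (sphere (0 :: real ^ 'p) 1) (\<lambda>x. x \<bullet> (A *v x))"
    by (intro continuous_intros)
  ultimately obtain x0 where x0: "norm x0 = 1"
    and min: "\<And>y. norm y = 1 \<Longrightarrow> x0 \<bullet> (A *v x0) \<le> y \<bullet> (A *v y)"
    using continuous_attains_inf[OF compact_sphere, of 0 1 "\<lambda>x. x \<bullet> (A *v x)"]
    by (auto simp: sphere_def)
  define m where "m = x0 \<bullet> (A *v x0)"
  have form: "m * (y \<bullet> y) \<le> y \<bullet> (A *v y)" for y
  proof (cases "y = 0")
    case False
    then have "m \<le> (y /\<^sub>R norm y) \<bullet> (A *v (y /\<^sub>R norm y))"
      unfolding m_def by (intro min) simp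
    also have "\<dots> = (y \<bullet> (A *v y)) / (norm y)\<^sup>2"
      by (simp add: matrix_vector_mult_scaleR power2_eq_square divide_inverse)
    finally show ?thesis
      using False by (simp add: field_simps dot_square_norm)
  qed simp
  \<comment> \<open>If this residual were nonzero, a small move from \<open>x0\<close> along
    \<open>- h\<close> would push the form below \<open>m\<close>.\<close>
  define h where "h = A *v x0 - m *\<^sub>R x0"
  define q where "q = h \<bullet> (A *v h) - m * (h \<bullet> h)"
  have q: "q \<ge> 0" using form[of h] by (simp add: q_def)
  have "0 \<le> 2 * t * (h \<bullet> h) + t\<^sup>2 * q" for t
  proof -
    have "(A *v h) \<bullet> x0 = h \<bullet> h + m * (h \<bullet> x0)"
      by (subst sym) (simp add: h_def inner_diff_right inner_diff_left)
    then have e1: "x0 \<bullet> (A *v h) = h \<bullet> h + m * (h \<bullet> x0)" by (simp add: inner_commute)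
    have e2: "h \<bullet> (A *v x0) = h \<bullet> h + m * (h \<bullet> x0)"
      by (simp add: h_def inner_diff_right inner_diff_left)
    have e3: "x0 \<bullet> x0 = 1" using x0 by (simp add: dot_square_norm)
    have "(x0 + t *\<^sub>R h) \<bullet> (A *v (x0 + t *\<^sub>R h)) - m * ((x0 + t *\<^sub>R h) \<bullet> (x0 + t *\<^sub>R h))
      = 2 * t * (h \<bullet> h) + t\<^sup>2 * q"
      by (simp add: q_def matrix_vector_right_distrib matrix_vector_mult_scaleR inner_add_left
          inner_add_right e1 e2 e3 m_def[symmetric] power2_eq_square algebra_simps inner_commute[of x0 h])
    then show ?thesis using form[of "x0 + t *\<^sub>R h"] by linarith
  qed
  note nonneg = this
  \<comment> \<open>At \<open>- t\<close> the bound \<open>nonneg\<close> becomes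
    \<open>0 \<le> - (t\<^sup>2 * (q + 2))\<close>; the \<open>+ 1\<close> keeps the denominator
    positive.\<close>
  define t where "t = (h \<bullet> h) / (q + 1)"
  have t: "h \<bullet> h = t * (q + 1)" using q by (simp add: t_def)
  have "0 \<le> - (t\<^sup>2 * (q + 2))"
    using nonneg[of "- t"] by (simp add: t power2_eq_square algebra_simps)
  then have "t = 0" using q by (simp add: mult_le_0_iff)
  then have "A *v x0 = m *\<^sub>R x0" using t by (simp add: h_def)
  moreover have "x0 \<noteq> 0" using x0 by auto
  ultimately have "m \<in> eigenvalues A" by (auto simp: eigenvalues_def)
  then have "lambda_min A \<le> m"
    unfolding lambda_min_def using finite_eigenvalues_symmetric[OF sym] by (rule_tac Min_le)
  then show ?thesis
    using form[of x] by (metis dot_square_norm mult_right_mono order_trans zero_le_power2)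
qed

text \<open>The mean value theorem along the segment produces the Hessian at an intermediate point;
  it is symmetric, so the eigenvalue bound applies to its quadratic form.\<close>

lemma strongly_convex_gradient_monotone:
  fixes a :: "real ^ 'p \<Rightarrow> real"
  assumes "strongly_convex \<alpha> a"
  shows "\<alpha> * (norm (y - x))\<^sup>2 \<le> (gradient a y - gradient a x) \<bullet> (y - x)"
proof -
  define g where "g = gradient a"
  define d where "d = y - x"
  define \<psi> where "\<psi> = (\<lambda>s. g (x + s *\<^sub>R d) \<bullet> d)"
  have a: "(a has_derivative (\<lambda>h. h \<bullet> g z)) (at z)" for z
    using assms gradient_has_derivative unfolding strongly_convex_def g_def by blast
  have g: "(g has_derivative (\<lambda>h. hessian a z *v h)) (at z)" for z
    using assms unfolding strongly_convex_def g_def hessian_def jacobian_works by blast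
  have "(\<psi> has_real_derivative (hessian a (x + s *\<^sub>R d) *v d) \<bullet> d) (at s)" for s
  proof -
    have "((\<lambda>s. x + s *\<^sub>R d) has_derivative (\<lambda>h. h *\<^sub>R d)) (at s)"
      by (auto intro!: derivative_eq_intros)
    from has_derivative_inner_left[OF has_derivative_compose[OF this g]] show ?thesis
      unfolding \<psi>_def has_field_derivative_def
      by (simp add: matrix_vector_mult_scaleR mult_commute_abs)
  qed
  from MVT2[OF zero_less_one this] obtain \<xi>
    where \<xi>: "\<psi> 1 - \<psi> 0 = (hessian a (x + \<xi> *\<^sub>R d) *v d) \<bullet> d" by auto
  define H where "H = hessian a (x + \<xi> *\<^sub>R d)"
  have "\<alpha> * (norm d)\<^sup>2 \<le> lambda_min H * (norm d)\<^sup>2"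
    using assms by (intro mult_right_mono) (auto simp: strongly_convex_def H_def)
  also have "\<dots> \<le> d \<bullet> (H *v d)"
    unfolding H_def
    by (rule lambda_min_le_quadratic_form) (rule second_derivative_symmetric[OF a g])
  also have "\<dots> = \<psi> 1 - \<psi> 0" by (simp add: \<xi> H_def inner_commute)
  finally show ?thesis by (simp add: \<psi>_def d_def g_def inner_diff_left)
qed

lemma strongly_convex_lower_bound:
  fixes a :: "real ^ 'p \<Rightarrow> real"
  assumes "strongly_convex \<alpha> a"
  shows "a x + gradient a x \<bullet> (y - x) + \<alpha> / 2 * (norm (y - x))\<^sup>2 \<le> a y"
proof -
  define d where "d = y - x"
  define \<phi> where "\<phi> = (\<lambda>s. a (x + s *\<^sub>R d) - s * (gradient a x \<bullet> d) - \<alpha> / 2 * s\<^sup>2 * (norm d)\<^sup>2)"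
  have "(\<phi> has_real_derivative
      (d \<bullet> gradient a (x + s *\<^sub>R d) - gradient a x \<bullet> d - \<alpha> * s * (norm d)\<^sup>2)) (at s)" for s
    unfolding \<phi>_def using assms unfolding strongly_convex_def
    by (auto intro!: derivative_eq_intros has_derivative_along_line gradient_has_derivative)
  from MVT2[OF zero_less_one this] obtain \<xi> where "0 < \<xi>"
    and eq: "\<phi> 1 - \<phi> 0 = d \<bullet> gradient a (x + \<xi> *\<^sub>R d) - gradient a x \<bullet> d - \<alpha> * \<xi> * (norm d)\<^sup>2"
    by auto
  \<comment> \<open>Monotonicity between \<open>x\<close> and \<open>x + \<xi> *\<^sub>R d\<close>
    carries an extra factor \<open>\<xi>\<close>, which is cancelled afterwards.\<close>
  have "\<xi> * (\<phi> 1 - \<phi> 0) \<ge> 0"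
    using strongly_convex_gradient_monotone[OF assms, where y = "x + \<xi> *\<^sub>R d" and x = x] \<open>0 < \<xi>\<close>
    unfolding eq by (simp add: inner_diff_left inner_commute power2_eq_square algebra_simps)
  then have "\<phi> 1 - \<phi> 0 \<ge> 0" using \<open>0 < \<xi>\<close> by (simp add: zero_le_mult_iff)
  then show ?thesis by (simp add: \<phi>_def d_def)
qed

lemma smooth_upper_bound:
  fixes a :: "real ^ 'p \<Rightarrow> real"
  assumes "smooth L a"
  shows "a y \<le> a x + gradient a x \<bullet> (y - x) + L / 2 * (norm (y - x))\<^sup>2"
proof -
  define d where "d = y - x"
  define \<phi> where "\<phi> = (\<lambda>s. a (x + s *\<^sub>R d) - s * (gradient a x \<bullet> d) - L / 2 * s\<^sup>2 * (norm d)\<^sup>2)"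
  have "(\<phi> has_real_derivative
      (d \<bullet> gradient a (x + s *\<^sub>R d) - gradient a x \<bullet> d - L * s * (norm d)\<^sup>2)) (at s)" for s
    unfolding \<phi>_def using assms unfolding smooth_def
    by (auto intro!: derivative_eq_intros has_derivative_along_line gradient_has_derivative)
  from MVT2[OF zero_less_one this] obtain \<xi> where "0 < \<xi>"
    and eq: "\<phi> 1 - \<phi> 0 = d \<bullet> gradient a (x + \<xi> *\<^sub>R d) - gradient a x \<bullet> d - L * \<xi> * (norm d)\<^sup>2"
    by auto
  define G where "G = gradient a (x + \<xi> *\<^sub>R d) - gradient a x"
  have "norm G \<le> L * norm ((x + \<xi> *\<^sub>R d) - x)"
    using assms unfolding smooth_def G_def by blast
  then have "norm G \<le> L * \<xi> * norm d" using \<open>0 < \<xi>\<close> by simp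
  then have "norm G * norm d \<le> L * \<xi> * norm d * norm d" by (rule mult_right_mono) simp
  moreover have "G \<bullet> d \<le> norm G * norm d" by (rule norm_cauchy_schwarz)
  ultimately have "\<phi> 1 - \<phi> 0 \<le> 0"
    unfolding eq G_def by (simp add: inner_diff_left inner_commute power2_eq_square algebra_simps)
  then show ?thesis by (simp add: \<phi>_def d_def)
qed

subsection \<open>Proximal steps\<close>

text \<open>A move of size \<open>\<theta>\<close> from \<open>p\<close> towards \<open>x\<close>
  changes the objective by at most a linear term in \<open>\<theta>\<close> plus a quadratic one, so
  the linear term cannot be negative. This serves both the proximal model and, with
  \<open>\<phi> = a\<close>, the minimizer of the whole objective.\<close>

lemma composite_optimality:
  fixes \<phi> b :: "'a::euclidean_space \<Rightarrow> real"
  assumes b: "convex_on UNIV b"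
    and \<phi>: "\<And>x. \<phi> x \<le> \<phi> p + G \<bullet> (x - p) + M / 2 * (norm (x - p))\<^sup>2"
    and min: "\<And>x. \<phi> p + b p \<le> \<phi> x + b x"
  shows "b p \<le> b x + G \<bullet> (x - p)"
proof (rule ccontr)
  define c where "c = b p - b x - G \<bullet> (x - p)"
  define K where "K = \<bar>M / 2 * (norm (x - p))\<^sup>2\<bar>"
  assume "\<not> b p \<le> b x + G \<bullet> (x - p)"
  then have c: "c > 0" by (simp add: c_def)
  \<comment> \<open>Small enough that the quadratic error \<open>\<theta> * K\<close> stays below
    the assumed violation \<open>c\<close>.\<close>
  define \<theta> where "\<theta> = c / (K + c + 1)"
  have K: "K \<ge> 0" by (simp add: K_def)
  have \<theta>: "0 < \<theta>" "\<theta> < 1" using c K by (auto simp: \<theta>_def)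
  have "\<theta> * K < c"
  proof -
    have "c * K < c * (K + c + 1)" using c by (intro mult_strict_left_mono) auto
    then show ?thesis using c K by (simp add: \<theta>_def divide_less_eq)
  qed
  define y where "y = (1 - \<theta>) *\<^sub>R p + \<theta> *\<^sub>R x"
  have y: "y - p = \<theta> *\<^sub>R (x - p)" by (simp add: y_def algebra_simps)
  have "b y \<le> (1 - \<theta>) * b p + \<theta> * b x"
    using convex_onD[OF b, of \<theta> p x] \<theta> unfolding y_def by simp
  moreover have "\<phi> y \<le> \<phi> p + \<theta> * (G \<bullet> (x - p)) + \<theta> * (\<theta> * (M / 2 * (norm (x - p))\<^sup>2))"
    using \<phi>[of y] by (simp add: y power_mult_distrib power2_eq_square mult_ac)
  moreover have "\<theta> * (\<theta> * (M / 2 * (norm (x - p))\<^sup>2)) \<le> \<theta> * (\<theta> * K)"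
    using \<theta> by (intro mult_left_mono) (auto simp: K_def)
  moreover have "\<phi> p + b p \<le> \<phi> y + b y" by (rule min)
  ultimately have "\<theta> * c \<le> \<theta> * (\<theta> * K)"
    by (simp add: c_def algebra_simps)
  then show False using \<theta> \<open>\<theta> * K < c\<close> by simp
qed

text \<open>Compactness bounds \<open>b\<close> from below on the unit ball, and convexity along
  rays from \<open>y\<close> extends the bound linearly. This gives the coercivity behind the
  existence of proximal points.\<close>

lemma convex_linear_lower_bound:
  fixes b :: "'a::euclidean_space \<Rightarrow> real"
  assumes "convex_on UNIV b" "continuous_on UNIV b"
  obtains C where "C \<ge> 0" "\<And>x. b y - C * (1 + norm (x - y)) \<le> b x"
proof -
  have "continuous_on (cball y 1) b" using assms(2) continuous_on_subset by blast
  then obtain x0 where "\<forall>x\<in>cball y 1. b x0 \<le> b x"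
    using continuous_attains_inf[OF compact_cball, of y 1 b] by auto
  then have x0: "b x0 \<le> b x" if "norm (x - y) \<le> 1" for x
    using that by (simp add: dist_norm norm_minus_commute)
  define C where "C = b y - b x0"
  have C: "C \<ge> 0" using x0[of y] by (simp add: C_def)
  have "b y - C * (1 + norm (x - y)) \<le> b x" for x
  proof (cases "norm (x - y) \<le> 1")
    case True
    then have "b y - C \<le> b x" using x0 by (simp add: C_def)
    moreover have "0 \<le> C * norm (x - y)" using C by simp
    ultimately show ?thesis by (simp add: algebra_simps)
  next
    case False
    define r where "r = norm (x - y)"
    have r: "r > 1" using False by (simp add: r_def)
    \<comment> \<open>The point of the segment from \<open>y\<close> to \<open>x\<close> at distance
      1 from \<open>y\<close>.\<close>
    have "b ((1 - 1 / r) *\<^sub>R y + (1 / r) *\<^sub>R x) \<le> (1 - 1 / r) * b y + (1 / r) * b x"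
      using convex_onD[OF assms(1), of "1 / r" y x] r by simp
    moreover have "b x0 \<le> b ((1 - 1 / r) *\<^sub>R y + (1 / r) *\<^sub>R x)"
    proof (rule x0)
      have "(1 - 1 / r) *\<^sub>R y + (1 / r) *\<^sub>R x - y = (1 / r) *\<^sub>R (x - y)"
        by (simp add: algebra_simps)
      then show "norm ((1 - 1 / r) *\<^sub>R y + (1 / r) *\<^sub>R x - y) \<le> 1"
        using r by (simp add: r_def)
    qed
    ultimately have "b x0 \<le> (1 - 1 / r) * b y + (1 / r) * b x" by linarith
    then have "r * b x0 \<le> (r - 1) * b y + b x"
      using r by (simp add: field_simps)
    then have "b y - C * r \<le> b x" by (simp add: C_def algebra_simps)
    then show ?thesis using C by (simp add: r_def algebra_simps)
  qed
  then show ?thesis using that C by blast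
qed

text \<open>\<open>arg_min\<close> is a mere choice, so a minimizer has to be exhibited: one exists
  on a closed ball, and outside it the quadratic term dominates.\<close>

lemma prox_step_minimal:
  fixes a b :: "real ^ 'p \<Rightarrow> real" and y :: "real ^ 'p"
  assumes b: "convex_on UNIV b" "continuous_on UNIV b" and "l > 0"
  defines "\<phi> \<equiv> \<lambda>x. gradient a y \<bullet> (x - y) + b x + l / 2 * (norm (x - y))\<^sup>2"
  shows "\<phi> (prox_step a b l y) \<le> \<phi> x"
proof -
  define G where "G = gradient a y"
  obtain C where C: "C \<ge> 0" "\<And>x. b y - C * (1 + norm (x - y)) \<le> b x"
    using convex_linear_lower_bound[OF b] by metis
  \<comment> \<open>For \<open>r > \<rho>\<close> this gives
    \<open>norm G + 2 * C \<le> l / 2 * r\<close>; one \<open>C\<close> pays for the slope of the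
    bound on \<open>b\<close>, the other for its constant term.\<close>
  define \<rho> where "\<rho> = 1 + 2 * (norm G + 2 * C) / l"
  have \<rho>: "\<rho> \<ge> 1" using C \<open>l > 0\<close> by (simp add: \<rho>_def)
  have "continuous_on (cball y \<rho>) \<phi>"
    unfolding \<phi>_def using b(2) by (intro continuous_intros continuous_on_subset[OF b(2)]) auto
  moreover have "cball y \<rho> \<noteq> {}" using \<rho> by auto
  ultimately obtain p where "\<forall>x\<in>cball y \<rho>. \<phi> p \<le> \<phi> x"
    using continuous_attains_inf[OF compact_cball, of y \<rho> \<phi>] by auto
  then have p: "\<phi> p \<le> \<phi> x" if "norm (x - y) \<le> \<rho>" for x
    using that by (simp add: dist_norm norm_minus_commute)
  have "\<phi> p \<le> \<phi> x" for x
  proof (cases "norm (x - y) \<le> \<rho>")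
    case False
    define r where "r = norm (x - y)"
    have r: "r > \<rho>" "r > 1" using False \<rho> by (auto simp: r_def)
    have "\<bar>G \<bullet> (x - y)\<bar> \<le> norm G * r" unfolding r_def by (rule Cauchy_Schwarz_ineq2)
    moreover have "b y - C * (1 + r) \<le> b x" using C r_def by auto
    moreover have "(norm G + 2 * C) * r \<le> l / 2 * r\<^sup>2"
    proof -
      have "norm G + 2 * C \<le> l / 2 * r"
        using r \<open>l > 0\<close> by (simp add: \<rho>_def field_simps)
      then have "(norm G + 2 * C) * r \<le> l / 2 * r * r" using r by (intro mult_right_mono) auto
      then show ?thesis by (simp add: power2_eq_square)
    qed
    moreover have "C * 1 \<le> C * r" using C r by (intro mult_left_mono) auto
    ultimately have "b y \<le> \<phi> x"
      unfolding \<phi>_def G_def[symmetric] r_def[symmetric] by (simp add: algebra_simps)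
    moreover have "\<phi> p \<le> \<phi> y" using \<rho> by (intro p) simp
    ultimately show ?thesis by (simp add: \<phi>_def)
  qed (rule p)
  then have "is_arg_min \<phi> (\<lambda>_. True) p" by (simp add: is_arg_min_linorder)
  then have "is_arg_min \<phi> (\<lambda>_. True) (prox_step a b l y)"
    unfolding prox_step_def arg_min_def \<phi>_def[symmetric] by (rule someI)
  then show ?thesis by (simp add: is_arg_min_linorder)
qed

text \<open>The quadratic model expands exactly around \<open>p\<close>, so optimality leaves the
  extra term \<open>l / 2 * (norm (p - x))\<^sup>2\<close>. Sufficient decrease at \<open>p\<close>
  and the linear lower bound at \<open>x\<close> then replace the model by \<open>a\<close>.\<close>

lemma prox_step_three_point:
  fixes a b :: "real ^ 'p \<Rightarrow> real" and y :: "real ^ 'p"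
  assumes b: "convex_on UNIV b" "continuous_on UNIV b" and "l > 0"
    and a: "\<And>x. a y + gradient a y \<bullet> (x - y) \<le> a x"
    and dec: "sufficient_decrease a b l y"
  defines "p \<equiv> prox_step a b l y"
  shows "a p + b p + l / 2 * (norm (p - x))\<^sup>2 \<le> a x + b x + l / 2 * (norm (y - x))\<^sup>2"
proof -
  define \<phi> where "\<phi> = (\<lambda>x. gradient a y \<bullet> (x - y) + l / 2 * (norm (x - y))\<^sup>2)"
  define G where "G = gradient a y + l *\<^sub>R (p - y)"
  have \<phi>: "\<phi> x = \<phi> p + G \<bullet> (x - p) + l / 2 * (norm (x - p))\<^sup>2" for x
  proof -
    define u where "u = p - y"
    define v where "v = x - p"
    have "x - y = u + v" by (simp add: u_def v_def)
    then show ?thesis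
      unfolding \<phi>_def G_def u_def[symmetric] v_def[symmetric]
      by (simp add: power2_norm_eq_inner algebra_simps inner_commute)
  qed
  have "b p \<le> b x + G \<bullet> (x - p)"
  proof (rule composite_optimality[OF b(1)])
    show "\<phi> x \<le> \<phi> p + G \<bullet> (x - p) + l / 2 * (norm (x - p))\<^sup>2" for x
      using \<phi>[of x] by simp
    show "\<phi> p + b p \<le> \<phi> x + b x" for x
      using prox_step_minimal[OF b \<open>l > 0\<close>, of a y x] by (simp add: \<phi>_def p_def)
  qed
  then have "\<phi> p + b p + l / 2 * (norm (p - x))\<^sup>2 \<le> \<phi> x + b x"
    using \<phi>[of x] by (simp add: norm_minus_commute)
  moreover have "a p \<le> a y + \<phi> p"
    using dec unfolding sufficient_decrease_def Let_def p_def[symmetric]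
    by (simp add: \<phi>_def inner_commute)
  moreover have "a y + \<phi> x \<le> a x + l / 2 * (norm (y - x))\<^sup>2"
    using a[of x] by (simp add: \<phi>_def norm_minus_commute)
  ultimately show ?thesis by linarith
qed

text \<open>Every trial value of at least \<open>L\<close> passes, so the search ends; a rejected
  trial lies below \<open>L\<close>, and the next one is \<open>\<eta>\<close> times as
  large.\<close>

lemma backtrack_correct:
  fixes a b :: "real ^ 'p \<Rightarrow> real" and z :: "real ^ 'p"
  assumes upper: "\<And>x. a x \<le> a z + gradient a z \<bullet> (x - z) + L / 2 * (norm (x - z))\<^sup>2"
    and "\<eta> > 1" "0 < l"
  defines "l' \<equiv> backtrack a b \<eta> l z"
  shows "sufficient_decrease a b l' z" "l \<le> l'" "l' \<le> max l (\<eta> * L)"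
proof -
  have dec: "sufficient_decrease a b m z" if "L \<le> m" for m
  proof -
    have "L / 2 * (norm (x - z))\<^sup>2 \<le> m / 2 * (norm (x - z))\<^sup>2" for x
      using that by (intro mult_right_mono) auto
    then show ?thesis
      unfolding sufficient_decrease_def Let_def
      using upper[of "prox_step a b m z"] by (smt (verit, best) inner_commute)
  qed
  define P where "P = (\<lambda>k. sufficient_decrease a b (\<eta> ^ k * l) z)"
  define k where "k = (LEAST k. P k)"
  have l': "l' = \<eta> ^ k * l" by (simp add: l'_def backtrack_def k_def P_def)
  obtain j where "L / l < \<eta> ^ j" using real_arch_pow[OF \<open>\<eta> > 1\<close>] by blast
  then have "P j" using \<open>0 < l\<close> by (auto simp: P_def field_simps intro!: dec)
  then have "P k" unfolding k_def by (rule LeastI)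
  then show "sufficient_decrease a b l' z" by (simp add: l' P_def)
  have "1 \<le> \<eta> ^ k" using \<open>\<eta> > 1\<close> by simp
  then show "l \<le> l'" using \<open>0 < l\<close> by (simp add: l')
  show "l' \<le> max l (\<eta> * L)"
  proof (cases k)
    case 0
    then show ?thesis by (simp add: l')
  next
    case (Suc i)
    then have "\<not> P i" unfolding k_def by (intro not_less_Least) simp
    then have "\<eta> ^ i * l < L" using dec[of "\<eta> ^ i * l"] by (force simp: P_def not_less)
    then have "\<eta> * (\<eta> ^ i * l) \<le> \<eta> * L" using \<open>\<eta> > 1\<close> by simp
    then show ?thesis by (simp add: l' Suc)
  qed
qed

subsection \<open>Accelerated gradient descent\<close>

text \<open>With \<open>q = \<lambda>\<^sup>t\<close>, the numbers \<open>y\<close>, \<open>y'\<close> are the squared distances of two consecutive iterates to the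
  minimizer, \<open>R2\<close> that of the starting point, and \<open>U\<close> is the distance term of the FISTA energy.\<close>

lemma momentum_contraction:
  fixes q \<kappa> y y' U R2 :: real
  assumes q: "q \<ge> 1" and \<kappa>: "\<kappa> > 0" and R2: "R2 \<ge> 0"
    and y: "y * (2 * \<kappa> + (q\<^sup>2 - q)) \<le> 2 * \<kappa> * R2"
    and y': "q * y' \<le> (q - 1) * y + U"
    and U: "q\<^sup>2 * y' \<le> \<kappa> * (R2 - U)"
  shows "y' * (2 * \<kappa> + q\<^sup>2) \<le> 2 * \<kappa> * R2"
proof -
  define D where "D = 2 * \<kappa> + (q\<^sup>2 - q)"
  have D: "D > 0" using q \<kappa> by (simp add: D_def power2_eq_square add_pos_nonneg)
  \<comment> \<open>Adding the energy bound cancels \<open>\<kappa> * U\<close>.\<close>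
  have "\<kappa> * (q * y') \<le> \<kappa> * ((q - 1) * y + U)"
    using y' \<kappa> by (intro mult_left_mono) auto
  with U have "q * y' * (\<kappa> + q) \<le> \<kappa> * ((q - 1) * y + R2)"
    by (simp add: power2_eq_square algebra_simps)
  then have "q * y' * (\<kappa> + q) * D \<le> \<kappa> * ((q - 1) * y + R2) * D"
    using D by (intro mult_right_mono) auto
  also have "\<dots> = \<kappa> * ((q - 1) * (y * D) + R2 * D)" by (simp add: algebra_simps)
  also have "\<dots> \<le> \<kappa> * ((q - 1) * (2 * \<kappa> * R2) + R2 * D)"
    using y q \<kappa> by (intro mult_left_mono add_right_mono) (auto simp: D_def)
  also have "\<dots> = q * (\<kappa> * R2 * (2 * \<kappa> + q - 1))"
    by (simp add: D_def power2_eq_square algebra_simps)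
  finally have 1: "y' * ((\<kappa> + q) * D) \<le> \<kappa> * R2 * (2 * \<kappa> + q - 1)"
    using q by (simp add: mult.assoc)
  \<comment> \<open>This trades the factor \<open>2 * \<kappa> + q - 1\<close> just obtained for the
    desired \<open>2 * \<kappa> + q\<^sup>2\<close>.\<close>
  have E: "(2 * \<kappa> + q\<^sup>2) * (2 * \<kappa> + q - 1) \<le> 2 * ((\<kappa> + q) * D)"
  proof -
    have "2 * ((\<kappa> + q) * D) - (2 * \<kappa> + q\<^sup>2) * (2 * \<kappa> + q - 1) = 2 * \<kappa> + q\<^sup>2 * (q - 1)"
      by (simp add: D_def power2_eq_square algebra_simps)
    moreover have "0 \<le> q\<^sup>2 * (q - 1)" using q by simp
    ultimately show ?thesis using \<kappa> by linarith
  qed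
  have pos: "(\<kappa> + q) * D > 0" using q \<kappa> D by simp
  have "y' * (2 * \<kappa> + q\<^sup>2) * ((\<kappa> + q) * D) = (y' * ((\<kappa> + q) * D)) * (2 * \<kappa> + q\<^sup>2)"
    by simp
  also have "\<dots> \<le> (\<kappa> * R2 * (2 * \<kappa> + q - 1)) * (2 * \<kappa> + q\<^sup>2)"
    using 1 \<kappa> by (intro mult_right_mono) auto
  also have "\<dots> = (\<kappa> * R2) * ((2 * \<kappa> + q\<^sup>2) * (2 * \<kappa> + q - 1))" by simp
  also have "\<dots> \<le> (\<kappa> * R2) * (2 * ((\<kappa> + q) * D))"
    using E \<kappa> R2 by (intro mult_left_mono) auto
  also have "\<dots> = 2 * \<kappa> * R2 * ((\<kappa> + q) * D)" by simp
  finally show ?thesis using pos by (rule mult_right_le_imp_le)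
qed

text \<open>Convexity of the squared norm with weights \<open>1 / q\<close> and
  \<open>(q - 1) / q\<close>, scaled by \<open>q\<^sup>2\<close>, with explicit defect.\<close>

lemma convex_combination_norm_square:
  fixes x y :: "'a::real_inner"
  assumes "q \<ge> 1"
  shows "(norm (x + (q - 1) *\<^sub>R y))\<^sup>2 \<le> q * ((norm x)\<^sup>2 + (q - 1) * (norm y)\<^sup>2)"
proof -
  have "q * ((norm x)\<^sup>2 + (q - 1) * (norm y)\<^sup>2) - (norm (x + (q - 1) *\<^sub>R y))\<^sup>2
        = (q - 1) * (norm (x - y))\<^sup>2"
    by (simp add: power2_norm_eq_inner algebra_simps inner_commute)
  also have "\<dots> \<ge> 0" using assms by simp
  finally show ?thesis by simp
qed

text \<open>The curvature of \<open>a\<close> enters through two quadratic bounds. The factor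
  \<open>\<eta>\<close> in \<open>\<kappa>\<close> allows for backtracking overshooting
  \<open>L\<close>.\<close>

locale composite_problem =
  fixes a b :: "real ^ 'p \<Rightarrow> real" and wstar :: "real ^ 'p" and \<alpha> L \<eta> \<kappa> :: real
  assumes alpha: "\<alpha> > 0"
    and lower: "\<And>x y. a x + gradient a x \<bullet> (y - x) + \<alpha> / 2 * (norm (y - x))\<^sup>2 \<le> a y"
    and upper: "\<And>x y. a y \<le> a x + gradient a x \<bullet> (y - x) + L / 2 * (norm (y - x))\<^sup>2"
    and b: "convex_on UNIV b" "continuous_on UNIV b"
    and min: "\<And>x. a wstar + b wstar \<le> a x + b x"
    and eta: "\<eta> > 1"
    and kappa: "\<kappa> = L * \<eta> / \<alpha>"
begin

definition gap :: "real ^ 'p \<Rightarrow> real" where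
  "gap x = (a x + b x) - (a wstar + b wstar)"

lemma gap_nonneg: "0 \<le> gap x"
  using min[of x] by (simp add: gap_def)

text \<open>Optimality makes the negative gradient of \<open>a\<close> at \<open>wstar\<close> a
  subgradient of \<open>b\<close>, so the quadratic growth of \<open>a\<close> passes to the
  gap.\<close>

lemma gap_lower_bound: "\<alpha> / 2 * (norm (x - wstar))\<^sup>2 \<le> gap x"
  using composite_optimality[OF b(1) upper min, of x] lower[where x = wstar and y = x]
  by (simp add: gap_def)

lemma alpha_le_L: "\<alpha> \<le> L"
proof -
  define y where "y = (axis undefined 1 :: real ^ 'p)"
  have "norm y = 1" by (simp add: y_def)
  then show ?thesis
    using order_trans[OF lower[where x = 0 and y = y] upper[where x = 0 and y = y]] by simp
qed

lemma kappa_ge_1: "1 \<le> \<kappa>"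
proof -
  have "\<alpha> * 1 \<le> L * \<eta>" using alpha_le_L eta alpha by (intro mult_mono) auto
  then show ?thesis using alpha by (simp add: kappa)
qed

text \<open>The three-point inequality is used at the convex combination of \<open>w\<close> and
  \<open>wstar\<close> with weight \<open>1 / q\<close> on \<open>wstar\<close>; multiplied by
  \<open>2 * q\<^sup>2\<close>, its distances become those of the FISTA energy.\<close>

lemma prox_step_gap:
  assumes "l > 0" "sufficient_decrease a b l z"
    and "q \<ge> 1"
  defines "p \<equiv> prox_step a b l z"
  shows "2 * q\<^sup>2 * gap p + l * (norm (q *\<^sub>R p - (q - 1) *\<^sub>R w - wstar))\<^sup>2
           \<le> 2 * (q\<^sup>2 - q) * gap w + l * (norm (q *\<^sub>R z - (q - 1) *\<^sub>R w - wstar))\<^sup>2"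
proof -
  define x where "x = (1 - 1 / q) *\<^sub>R w + (1 / q) *\<^sub>R wstar"
  have le: "0 \<le> 1 / q" "1 / q \<le> 1" using \<open>q \<ge> 1\<close> by auto
  have supp: "a y + gradient a y \<bullet> (c - y) \<le> a c" for c y
    using lower[where x = y and y = c] alpha zero_le_power2[of "norm (c - y)"]
    by (smt (verit, best) half_gt_zero mult_nonneg_nonneg)
  have "gap x \<le> (1 - 1 / q) * gap w + (1 / q) * gap wstar"
  proof -
    have "b x \<le> (1 - 1 / q) * b w + (1 / q) * b wstar"
      using convex_onD[OF b(1) le, of w wstar] unfolding x_def by simp
    moreover have "a x \<le> (1 - 1 / q) * a w + (1 / q) * a wstar"
    proof -
      have "(1 - 1 / q) * (a x + gradient a x \<bullet> (w - x)) \<le> (1 - 1 / q) * a w"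
        using le supp by (intro mult_left_mono) auto
      moreover have "(1 / q) * (a x + gradient a x \<bullet> (wstar - x)) \<le> (1 / q) * a wstar"
        using le supp by (intro mult_left_mono) auto
      moreover have "(1 - 1 / q) * (gradient a x \<bullet> (w - x)) + (1 / q) * (gradient a x \<bullet> (wstar - x)) = 0"
      proof -
        have "(1 - 1 / q) *\<^sub>R (w - x) + (1 / q) *\<^sub>R (wstar - x) = 0"
          by (simp add: x_def algebra_simps)
        then show ?thesis
          by (metis inner_add_right inner_scaleR_right inner_zero_right)
      qed
      ultimately show ?thesis by (simp add: algebra_simps)
    qed
    ultimately show ?thesis by (simp add: gap_def algebra_simps)
  qed
  then have gx: "gap x \<le> (1 - 1 / q) * gap w" by (simp add: gap_def)
  have "gap p + l / 2 * (norm (p - x))\<^sup>2 \<le> gap x + l / 2 * (norm (z - x))\<^sup>2"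
    using prox_step_three_point[OF b \<open>l > 0\<close> supp assms(2), of x]
    by (simp add: gap_def p_def)
  with gx have "gap p + l / 2 * (norm (p - x))\<^sup>2 \<le> (1 - 1 / q) * gap w + l / 2 * (norm (z - x))\<^sup>2"
    by linarith
  then have "(2 * q\<^sup>2) * (gap p + l / 2 * (norm (p - x))\<^sup>2)
      \<le> (2 * q\<^sup>2) * ((1 - 1 / q) * gap w + l / 2 * (norm (z - x))\<^sup>2)"
    by (intro mult_left_mono) auto
  then have 1: "2 * q\<^sup>2 * gap p + l * (q\<^sup>2 * (norm (p - x))\<^sup>2)
      \<le> 2 * (q\<^sup>2 - q) * gap w + l * (q\<^sup>2 * (norm (z - x))\<^sup>2)"
    using \<open>q \<ge> 1\<close> by (simp add: algebra_simps power2_eq_square)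
  have scale: "q\<^sup>2 * (norm (c - x))\<^sup>2 = (norm (q *\<^sub>R c - (q - 1) *\<^sub>R w - wstar))\<^sup>2" for c
  proof -
    have "q *\<^sub>R c - (q - 1) *\<^sub>R w - wstar = q *\<^sub>R (c - x)"
      using \<open>q \<ge> 1\<close> by (simp add: x_def algebra_simps)
    then show ?thesis by (simp add: power_mult_distrib)
  qed
  show ?thesis using 1 by (simp only: scale)
qed

text \<open>After \<open>t\<close> steps \<open>lam\<^sup>2 - lam\<close> is the square of the previous \<open>lam\<close>, or \<open>0\<close> if \<open>t = 0\<close>; this is the
  weight of the gap in the FISTA energy.\<close>

lemma agd_state_invariant:
  assumes l0: "0 < l0" "l0 \<le> L"
    and "agd_state a b \<eta> l0 v t = (w, z, lam, l)"
  shows "1 + t / 2 \<le> lam \<and> (t \<ge> 1 \<longrightarrow> ((real t + 1) / 2)\<^sup>2 \<le> lam\<^sup>2 - lam) \<and> 0 < l \<and> l \<le> \<eta> * L \<and>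
    2 * (lam\<^sup>2 - lam) * gap w + l * (norm (lam *\<^sub>R z - (lam - 1) *\<^sub>R w - wstar))\<^sup>2
       \<le> l * (norm (v - wstar))\<^sup>2 \<and>
    (norm (w - wstar))\<^sup>2 * (lam\<^sup>2 - lam) \<le> \<kappa> * (norm (v - wstar))\<^sup>2 \<and>
    (norm (w - wstar))\<^sup>2 * (2 * \<kappa> + (lam\<^sup>2 - lam)) \<le> 2 * \<kappa> * (norm (v - wstar))\<^sup>2"
  using assms(3)
proof (induction t arbitrary: w z lam l)
  case 0
  then show ?case
    using l0 eta kappa_ge_1 by (auto simp: algebra_simps intro: order_trans)
next
  case (Suc t)
  obtain w0 z0 q l1 where s: "agd_state a b \<eta> l0 v t = (w0, z0, q, l1)"
    by (metis prod_cases4)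
  define R2 where "R2 = (norm (v - wstar))\<^sup>2"
  define U0 where "U0 = (norm (q *\<^sub>R z0 - (q - 1) *\<^sub>R w0 - wstar))\<^sup>2"
  define U where "U = (norm (q *\<^sub>R w - (q - 1) *\<^sub>R w0 - wstar))\<^sup>2"
  define y0 where "y0 = (norm (w0 - wstar))\<^sup>2"
  define y where "y = (norm (w - wstar))\<^sup>2"
  from Suc.IH[OF s] have q: "1 + t / 2 \<le> q" and l1: "0 < l1" "l1 \<le> \<eta> * L"
    and G0: "2 * (q\<^sup>2 - q) * gap w0 + l1 * U0 \<le> l1 * R2"
    and y0: "y0 * (2 * \<kappa> + (q\<^sup>2 - q)) \<le> 2 * \<kappa> * R2"
    by (auto simp: R2_def U0_def y0_def)
  have l: "l = backtrack a b \<eta> l1 z0" and w: "w = prox_step a b l z0"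
    and lam: "lam = (1 + sqrt (1 + 4 * q\<^sup>2)) / 2"
    and z: "z = w + ((q - 1) / lam) *\<^sub>R (w - w0)"
    using Suc.prems unfolding agd_state.simps s Let_def prod.case prod.inject by safe
  have q1: "1 \<le> q" using q by simp
  have "2 * q \<le> sqrt (1 + 4 * q\<^sup>2)"
    by (rule real_le_rsqrt) (simp add: power_mult_distrib)
  then have lam_ge: "1 / 2 + q \<le> lam" by (simp add: lam)
  have "2 * lam = 1 + sqrt (1 + 4 * q\<^sup>2)" by (simp add: lam)
  then have "2 * lam - 1 = sqrt (1 + 4 * q\<^sup>2)" by simp
  then have "(2 * lam - 1)\<^sup>2 = 1 + 4 * q\<^sup>2" by (simp add: add_nonneg_nonneg)
  \<comment> \<open>The recursion takes \<open>lam\<close> as the positive root of this equation, so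
    the gap weight of the new state is the one the proximal step produces.\<close>
  then have lam_sq: "lam\<^sup>2 - lam = q\<^sup>2" by (simp add: power2_eq_square algebra_simps)
  have dec: "sufficient_decrease a b l z0" and ll: "l1 \<le> l" "l \<le> max l1 (\<eta> * L)"
    using backtrack_correct[where a = a and b = b and z = z0, OF upper eta l1(1)] by (auto simp: l)
  have l_pos: "0 < l" and l_le: "l \<le> \<eta> * L" using ll l1 by auto
  have "lam *\<^sub>R z = lam *\<^sub>R w + (q - 1) *\<^sub>R (w - w0)"
    using lam_ge q1 by (simp add: z scaleR_add_right)
  \<comment> \<open>The momentum coefficient is made for this: the energy point of the new state is
    the one controlled by the proximal step.\<close>
  then have U: "lam *\<^sub>R z - (lam - 1) *\<^sub>R w - wstar = q *\<^sub>R w - (q - 1) *\<^sub>R w0 - wstar"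
    by (simp add: algebra_simps)
  have R2: "0 \<le> R2" and U_nonneg: "0 \<le> U" "0 \<le> y" by (auto simp: R2_def U_def y_def)
  have step: "2 * q\<^sup>2 * gap w + l * U \<le> 2 * (q\<^sup>2 - q) * gap w0 + l * U0"
    unfolding U_def U0_def w by (rule prox_step_gap[OF l_pos dec q1])
  have "q\<^sup>2 - q \<ge> 0" using q1 by (simp add: power2_eq_square)
  then have "2 * (q\<^sup>2 - q) * gap w0 \<ge> 0" using gap_nonneg by simp
  with G0 have "l1 * U0 \<le> l1 * R2" by linarith
  then have "0 \<le> l1 * (R2 - U0)" by (simp add: right_diff_distrib)
  then have "0 \<le> R2 - U0" using l1 by (simp add: zero_le_mult_iff)
  \<comment> \<open>Backtracking may increase \<open>l\<close>; the energy bound survives since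
    \<open>U0 \<le> R2\<close>.\<close>
  then have "l1 * (R2 - U0) \<le> l * (R2 - U0)" using ll by (intro mult_right_mono)
  with step G0 have G: "2 * q\<^sup>2 * gap w + l * U \<le> l * R2"
    by (simp add: right_diff_distrib)
  have "0 \<le> 2 * q\<^sup>2 * gap w" using gap_nonneg by simp
  with G have "l * U \<le> l * R2" by linarith
  then have "0 \<le> l * (R2 - U)" by (simp add: right_diff_distrib)
  then have RU: "0 \<le> R2 - U" using l_pos by (simp add: zero_le_mult_iff)
  have "2 * q\<^sup>2 * (\<alpha> / 2 * y) \<le> 2 * q\<^sup>2 * gap w"
    unfolding y_def by (intro mult_left_mono gap_lower_bound) auto
  also have "\<dots> \<le> l * (R2 - U)" using G by (simp add: right_diff_distrib)
  also have "\<dots> \<le> \<eta> * L * (R2 - U)" using l_le RU by (rule mult_right_mono)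
  also have "\<eta> * L = \<alpha> * \<kappa>" using alpha by (simp add: kappa)
  finally have yU: "q\<^sup>2 * y \<le> \<kappa> * (R2 - U)" using alpha by (simp add: mult.left_commute[of _ \<alpha>] mult.assoc)
  \<comment> \<open>\<open>w\<close> is the convex combination of the energy point and
    \<open>w0\<close> with weight \<open>1 / q\<close> on the former.\<close>
  have "q * (q * y) \<le> q * ((q - 1) * y0 + U)"
  proof -
    have "q *\<^sub>R (w - wstar)
        = (q *\<^sub>R w - (q - 1) *\<^sub>R w0 - wstar) + (q - 1) *\<^sub>R (w0 - wstar)"
      by (simp add: algebra_simps)
    then have "q\<^sup>2 * y = (norm ((q *\<^sub>R w - (q - 1) *\<^sub>R w0 - wstar) + (q - 1) *\<^sub>R (w0 - wstar)))\<^sup>2"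
      unfolding y_def by (metis norm_scaleR power2_abs power_mult_distrib)
    also have "\<dots> \<le> q * (U + (q - 1) * y0)"
      unfolding U_def y0_def by (rule convex_combination_norm_square[OF q1])
    finally show ?thesis by (simp add: power2_eq_square add.commute mult.assoc)
  qed
  then have "q * y \<le> (q - 1) * y0 + U" using q1 by simp
  from momentum_contraction[OF q1 _ R2 y0 this yU] kappa_ge_1
  have "y * (2 * \<kappa> + q\<^sup>2) \<le> 2 * \<kappa> * R2" by simp
  moreover have "y * q\<^sup>2 \<le> \<kappa> * R2"
  proof -
    have "0 \<le> \<kappa> * U" using U_nonneg kappa_ge_1 by simp
    then show ?thesis using yU by (simp add: algebra_simps)
  qed
  moreover have "((real (Suc t) + 1) / 2)\<^sup>2 \<le> q\<^sup>2" using q by (intro power_mono) auto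
  moreover have "1 + real (Suc t) / 2 \<le> lam"
    using lam_ge q unfolding of_nat_Suc add_divide_distrib by linarith
  ultimately show ?case
    unfolding U U_def[symmetric] R2_def[symmetric] y_def[symmetric] lam_sq
    using l_pos l_le G by auto
qed

text \<open>From the first step on, the energy weight \<open>lam\<^sup>2 - lam\<close> is at least
  \<open>\<kappa> * X\<^sup>2\<close>; at \<open>t = 0\<close> it vanishes.\<close>

lemma agd_distance_bounds:
  fixes v :: "real ^ 'p"
  assumes l0: "0 < l0" "l0 \<le> L" and t: "t \<ge> 1"
  defines "W \<equiv> norm (agd a b \<eta> l0 v t - wstar)" and "R \<equiv> norm (v - wstar)"
    and "X \<equiv> (real t + 1) / (2 * sqrt \<kappa>)"
  shows "X * W \<le> R" "(1 + X\<^sup>2 / 2) * W\<^sup>2 \<le> R\<^sup>2"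
proof -
  obtain w z lam l where s: "agd_state a b \<eta> l0 v t = (w, z, lam, l)"
    by (metis prod_cases4)
  have W: "W = norm (w - wstar)" by (simp add: W_def agd_def s)
  have \<kappa>: "\<kappa> > 0" using kappa_ge_1 by simp
  have "\<kappa> * X\<^sup>2 = ((real t + 1) / 2)\<^sup>2"
    using \<kappa> by (simp add: X_def power_divide power_mult_distrib)
  then have lam: "\<kappa> * X\<^sup>2 \<le> lam\<^sup>2 - lam"
    and 1: "W\<^sup>2 * (lam\<^sup>2 - lam) \<le> \<kappa> * R\<^sup>2"
    and 2: "W\<^sup>2 * (2 * \<kappa> + (lam\<^sup>2 - lam)) \<le> 2 * \<kappa> * R\<^sup>2"
    using agd_state_invariant[OF l0 s] t by (auto simp: W R_def)
  have "W\<^sup>2 * (\<kappa> * X\<^sup>2) \<le> W\<^sup>2 * (lam\<^sup>2 - lam)" using lam by (intro mult_left_mono) auto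
  with 1 have "\<kappa> * (X * W)\<^sup>2 \<le> \<kappa> * R\<^sup>2" by (simp add: power_mult_distrib mult_ac)
  then have "(X * W)\<^sup>2 \<le> R\<^sup>2" using \<kappa> by simp
  then show "X * W \<le> R" by (rule power2_le_imp_le) (simp add: R_def)
  have "W\<^sup>2 * (2 * \<kappa> + \<kappa> * X\<^sup>2) \<le> W\<^sup>2 * (2 * \<kappa> + (lam\<^sup>2 - lam))"
    using lam by (intro mult_left_mono) auto
  with 2 have "(2 * \<kappa>) * ((1 + X\<^sup>2 / 2) * W\<^sup>2) \<le> (2 * \<kappa>) * R\<^sup>2"
    by (simp add: algebra_simps)
  then show "(1 + X\<^sup>2 / 2) * W\<^sup>2 \<le> R\<^sup>2" using \<kappa> by simp
qed

end

text \<open>It suffices that \<open>(X\<^sup>2 + X + 4) * W \<le> (X + 4) * R\<close>. The linear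
  contraction gives this for large \<open>X\<close>, the quadratic one for small \<open>X\<close>;
  with the constant 4 all terms up to degree two cancel in the latter case.\<close>

lemma displacement_lower_bound:
  fixes X W R \<delta> :: real
  assumes "0 \<le> X" "0 \<le> W" "0 \<le> \<delta>" and \<delta>: "R \<le> W + \<delta>"
    and 1: "X * W \<le> R" and 2: "(1 + X\<^sup>2 / 2) * W\<^sup>2 \<le> R\<^sup>2"
  shows "X\<^sup>2 * W \<le> (X + 4) * \<delta>"
proof -
  have "(X\<^sup>2 + X + 4) * W \<le> (X + 4) * R"
  proof (cases "X \<le> 4")
    case False
    then have "(X\<^sup>2 + X + 4) * W \<le> ((X + 4) * X) * W"
      using \<open>0 \<le> W\<close> by (intro mult_right_mono) (auto simp: power2_eq_square algebra_simps)
    also have "\<dots> \<le> (X + 4) * R" using 1 \<open>0 \<le> X\<close> by (simp add: mult.assoc)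
    finally show ?thesis .
  next
    case True
    have R: "0 \<le> R" using 1 \<open>0 \<le> X\<close> \<open>0 \<le> W\<close> by (meson mult_nonneg_nonneg order_trans)
    have "(X\<^sup>2 + X + 4)\<^sup>2 \<le> (X + 4)\<^sup>2 * (1 + X\<^sup>2 / 2)"
    proof -
      have "(X + 4)\<^sup>2 * (1 + X\<^sup>2 / 2) - (X\<^sup>2 + X + 4)\<^sup>2 = X\<^sup>2 * (X * (4 - X)) / 2"
        by (simp add: power2_eq_square field_simps)
      also have "\<dots> \<ge> 0" using True \<open>0 \<le> X\<close> by simp
      finally show ?thesis by simp
    qed
    then have "(X\<^sup>2 + X + 4)\<^sup>2 * W\<^sup>2 \<le> (X + 4)\<^sup>2 * (1 + X\<^sup>2 / 2) * W\<^sup>2"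
      by (rule mult_right_mono) simp
    also have "\<dots> \<le> (X + 4)\<^sup>2 * R\<^sup>2"
      using 2 by (simp add: mult.assoc mult_left_mono)
    finally have "((X\<^sup>2 + X + 4) * W)\<^sup>2 \<le> ((X + 4) * R)\<^sup>2"
      by (simp add: power_mult_distrib)
    then show ?thesis
      by (rule power2_le_imp_le) (use R \<open>0 \<le> X\<close> in auto)
  qed
  also have "\<dots> \<le> (X + 4) * (W + \<delta>)" using \<delta> \<open>0 \<le> X\<close> by (intro mult_left_mono) auto
  finally show ?thesis by (simp add: algebra_simps)
qed

subsection \<open>Epoch lengths\<close>

text \<open>Up to 1 the constant \<open>3 * ln 2 \<ge> 2\<close> pays. Between 1 and 8 the logarithm
  lies above its chord, whose slope \<open>3 * ln 2 / 7\<close> is at least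
  \<open>2 / 7\<close>.\<close>

lemma short_epoch_cost:
  fixes y :: real
  assumes "0 < y" "y \<le> 8"
  shows "2 * y \<le> 3 * ln 2 + 7 * ln (max 1 y)"
proof (cases "y \<le> 1")
  case True
  then show ?thesis using ln2_ge_two_thirds by (simp add: max_def)
next
  case False
  define \<theta> where "\<theta> = (y - 1) / 7"
  have \<theta>: "0 \<le> \<theta>" "\<theta> \<le> 1" using False assms by (auto simp: \<theta>_def)
  have "\<theta> * ln 8 + (1 - \<theta>) * ln 1 \<le> ln (\<theta> *\<^sub>R 8 + (1 - \<theta>) *\<^sub>R (1::real))"
    using concave_onD[OF ln_concave, of \<theta> 1 8] \<theta> by (simp add: add.commute)
  moreover have "\<theta> *\<^sub>R 8 + (1 - \<theta>) *\<^sub>R 1 = y" by (simp add: \<theta>_def field_simps)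
  moreover have "ln (8::real) = 3 * ln 2" using ln_realpow[of 2 3] by simp
  ultimately have "3 * (\<theta> * ln 2) \<le> ln y" by simp
  moreover have "\<theta> * (2 / 3) \<le> \<theta> * ln 2" using \<theta> ln2_ge_two_thirds by (intro mult_left_mono) auto
  ultimately have "7 * (2 * \<theta>) \<le> 7 * ln y" by simp
  moreover have "7 * \<theta> = y - 1" by (simp add: \<theta>_def)
  ultimately show ?thesis using False ln2_ge_two_thirds by (simp add: max_def)
qed

text \<open>For \<open>y > 8\<close> the square dominates \<open>9 * y - 8\<close>, which makes the
  hypothesis linear. The second conclusion reads
  \<open>2 * y + 2 * (y - 8) \<le> 2 * (p - 8) + 16\<close>, the form in which costs are
  charged.\<close>

lemma long_epoch_decrease:
  fixes y p :: real
  assumes "8 < y" "y\<^sup>2 \<le> 9 / 2 * (p + 9 / 2)"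
  shows "y \<le> p" "4 * y \<le> 2 * p + 16"
proof -
  have "8 * y \<le> y\<^sup>2" using assms(1) by (simp add: power2_eq_square)
  moreover have "0 \<le> (y - 8) * (4 * y - 4)" using assms(1) by simp
  ultimately show "y \<le> p" "4 * y \<le> 2 * p + 16"
    using assms by (simp_all add: power2_eq_square algebra_simps)
qed

text \<open>Below, \<open>Y i = \<tau> i / (2 \<surd>\<kappa>)\<close> and \<open>Y i + r = (\<tau> i + 1) / (2 \<surd>\<kappa>)\<close>, \<open>e i\<close> is the error after epoch \<open>i\<close>,
  and \<open>D i\<close> is \<open>4 \<kappa>\<close> times the quotient compared by the stopping rule.\<close>

locale epoch_sequence =
  fixes Y e D :: "nat \<Rightarrow> real" and r :: real and n :: nat
  assumes n: "n \<ge> 1"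
    and r: "0 \<le> r" "r \<le> 1 / 2"
    and Y: "i \<in> {1..n} \<Longrightarrow> Y i > 0"
    and e: "i < n \<Longrightarrow> e i > 0"
    and mono: "i \<in> {1..n} \<Longrightarrow> e i \<le> e (i - 1)"
    and contr: "i \<in> {1..n} \<Longrightarrow> Y i * e i \<le> e (i - 1)"
    and D_decay: "i \<in> {2..n} \<Longrightarrow> D i \<le> D (i - 1) / 4"
    and D_lower: "i \<in> {1..n} \<Longrightarrow> e i \<le> (Y i + r + 4) * D i"
    and D_upper: "D 1 \<le> 2 * e 0 / (Y 1 + r)\<^sup>2"
    and long: "i \<in> {2..n} \<Longrightarrow> Y i > 8 \<Longrightarrow> (Y i)\<^sup>2 \<le> 9 / 2 * (Y (i - 1) + 9 / 2)"
begin

lemma length_bound: "m \<in> {1..n} \<Longrightarrow> Y m \<le> max 8 (Y 1)"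
proof (induction m)
  case (Suc m)
  show ?case
  proof (cases "m = 0 \<or> Y (Suc m) \<le> 8")
    case False
    then have "Y (Suc m) \<le> Y m"
      using long_epoch_decrease(1) long[of "Suc m"] Suc.prems by auto
    then show ?thesis using False Suc by simp
  qed auto
qed simp

text \<open>An epoch longer than 8 pays for its excess length by the drop from the previous length.\<close>

lemma epoch_cost:
  assumes "i \<in> {2..n}"
  shows "2 * Y i + 2 * max 0 (Y i - 8)
           \<le> 2 * max 0 (Y (i - 1) - 8) + min 16 (3 * ln 2 + 7 * ln (max 1 (Y i)))"
proof (cases "Y i \<le> 8")
  case True
  then have "2 * Y i \<le> min 16 (3 * ln 2 + 7 * ln (max 1 (Y i)))"
    using short_epoch_cost[of "Y i"] Y[of i] assms by simp
  then show ?thesis using True by (simp add: add_increasing)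
next
  case False
  then have "4 * Y i \<le> 2 * Y (i - 1) + 16"
    using long_epoch_decrease(2) long assms by auto
  \<comment> \<open>By \<open>24 * ln 2 \<ge> 16\<close>, the minimum in the claim is 16
    here.\<close>
  moreover have "16 \<le> 3 * ln 2 + 7 * ln (max 1 (Y i))"
  proof -
    have "ln 8 \<le> ln (Y i)" using False by simp
    moreover have "ln (8::real) = 3 * ln 2" using ln_realpow[of 2 3] by simp
    ultimately show ?thesis using False ln2_ge_two_thirds by (simp add: max_def)
  qed
  ultimately show ?thesis using False by auto
qed

lemma contraction_ln:
  assumes "i \<in> {1..n}" "e i > 0"
  shows "ln (max 1 (Y i)) \<le> ln (e (i - 1) / e i)"
proof -
  have "max 1 (Y i) \<le> e (i - 1) / e i"
    using mono[OF assms(1)] contr[OF assms(1)] assms(2) by (simp add: field_simps max_def)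
  then show ?thesis by simp
qed

text \<open>The costs telescope: excess lengths cancel and logarithms of error quotients add up. The
  first epoch is charged its own length and excess.\<close>

lemma total_cost:
  assumes "m \<in> {1..n}" "e m > 0"
  shows "(\<Sum>i=1..m. 2 * Y i) + 2 * max 0 (Y m - 8)
           \<le> 2 * Y 1 + 2 * max 0 (Y 1 - 8) + 3 * ln 2 * (real m - 1) + 7 * ln (e 0 / e m)"
  using assms
proof (induction m)
  case (Suc m)
  show ?case
  proof (cases "m = 0")
    case True
    have "ln (max 1 (Y 1)) \<le> ln (e 0 / e 1)" using contraction_ln[of 1] Suc.prems True by simp
    moreover have "0 \<le> ln (max 1 (Y 1))" by simp
    ultimately have "0 \<le> ln (e 0 / e 1)" by linarith
    then show ?thesis using True by simp
  next
    case False
    then have em: "e m > 0" using e Suc.prems by simp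
    have "2 * Y (Suc m) + 2 * max 0 (Y (Suc m) - 8)
        \<le> 2 * max 0 (Y m - 8) + 3 * ln 2 + 7 * ln (max 1 (Y (Suc m)))"
      using epoch_cost[of "Suc m"] Suc.prems False by simp
    moreover have "ln (max 1 (Y (Suc m))) \<le> ln (e m / e (Suc m))"
      using contraction_ln[of "Suc m"] Suc.prems by simp
    moreover have "ln (e 0 / e (Suc m)) = ln (e 0 / e m) + ln (e m / e (Suc m))"
      using em Suc.prems e[of 0] by (simp add: ln_div)
    moreover have "3 * ln 2 * (real (Suc m) - 1) = 3 * ln 2 * (real m - 1) + 3 * ln (2::real)"
      by (simp add: algebra_simps)
    moreover have "(\<Sum>i=1..Suc m. 2 * Y i) = (\<Sum>i=1..m. 2 * Y i) + 2 * Y (Suc m)" by simp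
    moreover have "(\<Sum>i=1..m. 2 * Y i) + 2 * max 0 (Y m - 8)
        \<le> 2 * Y 1 + 2 * max 0 (Y 1 - 8) + 3 * ln 2 * (real m - 1) + 7 * ln (e 0 / e m)"
      using Suc.IH em Suc.prems False by simp
    ultimately show ?thesis by argo
  qed
qed simp

lemma D_bound: "m \<in> {1..n} \<Longrightarrow> 4 ^ (m - 1) * D m \<le> D 1"
proof (induction m)
  case (Suc m)
  show ?case
  proof (cases "m = 0")
    case False
    then obtain k where k: "m = Suc k" using not0_implies_Suc by blast
    have "4 ^ k * (4 * D (Suc m)) \<le> 4 ^ k * D m"
      using D_decay[of "Suc m"] Suc.prems False by (intro mult_left_mono) auto
    also have "\<dots> \<le> D 1" using Suc.IH Suc.prems k by simp
    finally show ?thesis using k by (simp add: mult_ac)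
  qed simp
qed simp

text \<open>\<open>D\<close> falls by a factor 4 per epoch but bounds the error from above up to the
  factor \<open>Y m + r + 4\<close>, which the bound on the lengths controls.\<close>

lemma epoch_count:
  assumes m: "m \<in> {1..n}" and em: "e m > 0"
  shows "4 ^ (m - 1) \<le> 2 * (max 8 (Y 1) + 9 / 2) / (Y 1)\<^sup>2 * (e 0 / e m)"
proof -
  define M where "M = max 8 (Y 1) + 9 / 2"
  have Y1: "Y 1 > 0" using Y n by simp
  have M: "Y m + r + 4 \<le> M" "M > 0" using length_bound[OF m] r by (auto simp: M_def)
  have Ym: "0 < Y m + r + 4" using Y[OF m] r by simp
  have "0 < D m" using D_lower[OF m] em Ym by (smt (verit) zero_less_mult_pos)
  then have "e m \<le> M * D m" using D_lower[OF m] M by (smt (verit) mult_right_mono)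
  then have "4 ^ (m - 1) * e m \<le> 4 ^ (m - 1) * (M * D m)" by simp
  also have "\<dots> = M * (4 ^ (m - 1) * D m)" by simp
  also have "\<dots> \<le> M * (2 * e 0 / (Y 1 + r)\<^sup>2)"
    using D_bound[OF m] D_upper M by (intro mult_left_mono) auto
  also have "\<dots> \<le> M * (2 * e 0 / (Y 1)\<^sup>2)"
    using Y1 r M e[of 0] n by (intro mult_left_mono divide_left_mono power_mono) auto
  also have "\<dots> = 2 * M / (Y 1)\<^sup>2 * (e 0 / e m) * e m" using em by simp
  finally show ?thesis unfolding M_def using em by (rule mult_right_le_imp_le)
qed

lemma sum_lengths_bound:
  assumes \<epsilon>: "0 < \<epsilon>" "\<epsilon> < 1" and e_large: "\<And>i. i \<ge> 1 \<Longrightarrow> i < n \<Longrightarrow> \<epsilon> * e 0 < e i"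
  shows "(\<Sum>i=1..n. 2 * Y i) \<le> 17 / 2 * ln (8 / \<epsilon>) + max (26 * ln (6 / Y 1)) (4 * Y 1)"
proof -
  have Y1: "Y 1 > 0" using Y n by simp
  have ln8: "ln (8 / \<epsilon>) = 3 * ln 2 + ln (1 / \<epsilon>)"
    using \<epsilon> ln_realpow[of 2 3] by (simp add: ln_div)
  have ln_\<epsilon>: "0 \<le> ln (1 / \<epsilon>)" using \<epsilon> by simp
  show ?thesis
  proof (cases "n = 1")
    case True
    then have "(\<Sum>i=1..n. 2 * Y i) \<le> 4 * Y 1" using Y1 by simp
    also have "\<dots> \<le> max (26 * ln (6 / Y 1)) (4 * Y 1)" by simp
    finally show ?thesis using ln8 ln_\<epsilon> ln2_ge_two_thirds by linarith
  next
    case False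
    \<comment> \<open>The error is known to exceed \<open>\<epsilon> * e 0\<close> only up to epoch
      \<open>n - 1\<close>; the last epoch is charged the alternative 16 of
      \<open>epoch_cost\<close>.\<close>
    define m where "m = n - 1"
    have m: "m \<in> {1..n}" "m < n" "n = Suc m" using False n by (auto simp: m_def)
    have em: "e m > 0" "\<epsilon> * e 0 < e m" using e e_large m by auto
    define M where "M = max 8 (Y 1) + 9 / 2"
    define \<rho> where "\<rho> = ln (e 0 / e m)"
    have "e 0 / e m \<le> 1 / \<epsilon>" using em \<epsilon> by (simp add: field_simps)
    then have \<rho>: "\<rho> \<le> ln (1 / \<epsilon>)"
      unfolding \<rho>_def using em e[of 0] n by (intro ln_mono) auto
    have "ln (4 ^ (m - 1)) \<le> ln (2 * M / (Y 1)\<^sup>2 * (e 0 / e m))"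
      unfolding M_def using epoch_count[OF m(1) em(1)] by (intro ln_mono) auto
    also have "\<dots> = ln (2 * M / (Y 1)\<^sup>2) + \<rho>"
      unfolding \<rho>_def using Y1 em e[of 0] n by (subst ln_mult) (auto simp: M_def)
    also have "ln (4 ^ (m - 1)) = (real m - 1) * (2 * ln (2::real))"
      using m ln_realpow[of 4 "m - 1"] ln_realpow[of 2 2] by (simp add: of_nat_diff)
    \<comment> \<open>As \<open>ln 4 = 2 * ln 2\<close>, the price \<open>3 * ln 2\<close> per epoch
      adds weight \<open>3 / 2\<close> to the 7 on \<open>\<rho>\<close>, in total
      \<open>17 / 2\<close>.\<close>
    finally have count: "3 * ln 2 * (real m - 1) \<le> 3 / 2 * ln (2 * M / (Y 1)\<^sup>2) + 3 / 2 * \<rho>"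
      by (simp add: algebra_simps)
    have "(\<Sum>i=1..n. 2 * Y i) = (\<Sum>i=1..m. 2 * Y i) + 2 * Y n" by (simp add: m(3))
    also have "2 * Y n \<le> 2 * max 0 (Y m - 8) + 16"
    proof -
      have "2 * Y n + 2 * max 0 (Y n - 8)
          \<le> 2 * max 0 (Y m - 8) + min 16 (3 * ln 2 + 7 * ln (max 1 (Y n)))"
        using epoch_cost[of n] m by simp
      moreover have "min 16 (3 * ln 2 + 7 * ln (max 1 (Y n))) \<le> 16" "0 \<le> max 0 (Y n - 8)"
        by simp_all
      ultimately show ?thesis by argo
    qed
    finally have "(\<Sum>i=1..n. 2 * Y i)
        \<le> 16 + 2 * Y 1 + 2 * max 0 (Y 1 - 8) + 3 / 2 * ln (2 * M / (Y 1)\<^sup>2) + 17 / 2 * \<rho>"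
      using total_cost[OF m(1) em(1)] count unfolding \<rho>_def[symmetric] by linarith
    \<comment> \<open>The summand 1 is the slack between 16 and
      \<open>17 / 2 * ln 8 \<ge> 17\<close>.\<close>
    moreover have "1 + max (26 * ln (6 / Y 1)) (4 * Y 1)
        \<ge> 2 * Y 1 + 2 * max 0 (Y 1 - 8) + 3 / 2 * ln (2 * M / (Y 1)\<^sup>2)"
    proof (cases "Y 1 \<ge> 8")
      case True
      have "8 * Y 1 \<le> (Y 1)\<^sup>2" using True by (simp add: power2_eq_square)
      then have "2 * M / (Y 1)\<^sup>2 \<le> 1"
        using True by (simp add: M_def divide_le_eq)
      then have "ln (2 * M / (Y 1)\<^sup>2) \<le> 0"
        using True by (simp add: M_def)
      then show ?thesis using True by (simp add: max_def)
    next
      case False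
      then have "2 * M / (Y 1)\<^sup>2 = (5 / Y 1)\<^sup>2" by (simp add: M_def power_divide)
      then have lnM: "3 / 2 * ln (2 * M / (Y 1)\<^sup>2) = 3 * ln (5 / Y 1)"
        using Y1 by (simp add: ln_realpow)
      show ?thesis
      proof (cases "Y 1 \<ge> 2")
        case True
        have "ln (5 / Y 1) \<le> 5 / Y 1 - 1" using Y1 by (intro ln_le_minus_one) simp
        also have "\<dots> \<le> 3 / 2" using True by (simp add: field_simps)
        finally show ?thesis using False True lnM by (simp add: max_def)
      next
        case small: False
        have "ln (5 / Y 1) \<le> ln (6 / Y 1)" using Y1 by (simp add: divide_right_mono)
        moreover have "1 \<le> ln (6 / Y 1)"
        proof -
          have "exp 1 \<le> (3::real)" by (rule exp_le)
          also have "3 \<le> 6 / Y 1" using small Y1 by (simp add: field_simps)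
          finally show ?thesis using Y1 by (simp add: ln_ge_iff)
        qed
        ultimately show ?thesis using small lnM by (simp add: max_def)
      qed
    qed
    ultimately show ?thesis using ln8 \<rho> ln2_ge_two_thirds by argo
  qed
qed

end

subsection \<open>Adaptive restarts\<close>

locale restarted_problem = composite_problem a b wstar \<alpha> L \<eta> \<kappa>
  for a b :: "real ^ 'p \<Rightarrow> real" and wstar \<alpha> L \<eta> \<kappa> +
  fixes l0 :: real and v :: "nat \<Rightarrow> real ^ 'p" and \<tau> :: "nat \<Rightarrow> nat"
  assumes l0: "0 < l0" "l0 \<le> L"
    and run: "restarted_agd a b \<eta> l0 (1 / 4) v \<tau>"
begin

definition s :: real where "s = sqrt \<kappa>"
definition len :: "nat \<Rightarrow> real" where "len i = real (\<tau> i) / (2 * s)"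
definition err :: "nat \<Rightarrow> real" where "err i = norm (v i - wstar)"
definition disp :: "nat \<Rightarrow> real" where "disp i = norm (v i - v (i - 1))"
definition ratio :: "nat \<Rightarrow> real" where "ratio i = disp i / (len i + 1 / (2 * s))\<^sup>2"

lemma s_ge_1: "1 \<le> s"
  using kappa_ge_1 by (simp add: s_def)

lemma len_shift: "len i + 1 / (2 * s) = (real (\<tau> i) + 1) / (2 * s)"
  by (simp add: len_def add_divide_distrib)

lemma shift_bounds: "0 \<le> 1 / (2 * s)" "1 / (2 * s) \<le> 1 / 2"
  using s_ge_1 by auto

lemma ratio_eq: "ratio i = (2 * s)\<^sup>2 * (disp i / (real (\<tau> i) + 1)\<^sup>2)"
  by (simp add: ratio_def len_shift power_divide)

lemma stop_test_iff:
  "stop_test a b \<eta> l0 (1 / 4) v \<tau> i t \<longleftrightarrow>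
     norm (agd a b \<eta> l0 (v (i - 1)) t - v (i - 1)) / ((real t + 1) / (2 * s))\<^sup>2 \<le> ratio (i - 1) / 4"
proof -
  have *: "disp (i - 1) = norm (v (i - 1) - v (i - 2))" by (simp add: disp_def numeral_2_eq_2)
  have "norm (agd a b \<eta> l0 (v (i - 1)) t - v (i - 1)) / ((real t + 1) / (2 * s))\<^sup>2
      = (2 * s)\<^sup>2 * (norm (agd a b \<eta> l0 (v (i - 1)) t - v (i - 1)) / (real t + 1)\<^sup>2)"
    by (simp add: power_divide)
  moreover have "ratio (i - 1) / 4 = (2 * s)\<^sup>2 * (1 / 4 * (disp (i - 1) / (real (\<tau> (i - 1)) + 1)\<^sup>2))"
    by (simp add: ratio_eq)
  moreover have "0 < (2 * s)\<^sup>2" using s_ge_1 by simp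
  ultimately show ?thesis
    unfolding stop_test_def *[symmetric] by (simp only: mult_le_cancel_left_pos)
qed

lemma v_eq: "i \<ge> 1 \<Longrightarrow> v i = agd a b \<eta> l0 (v (i - 1)) (\<tau> i)"
  using run by (simp add: restarted_agd_def)

text \<open>The step count \<open>t\<close> is free because the bounds are used at the end of an
  epoch, one step earlier, and for large \<open>t\<close> to prove termination.\<close>

lemma agd_bounds:
  assumes "t \<ge> 1"
  shows "(real t + 1) / (2 * s) * norm (agd a b \<eta> l0 (v i) t - wstar) \<le> err i"
    and "norm (agd a b \<eta> l0 (v i) t - wstar) \<le> err i"
    and "((real t + 1) / (2 * s))\<^sup>2 * norm (agd a b \<eta> l0 (v i) t - wstar)
           \<le> ((real t + 1) / (2 * s) + 4) * norm (agd a b \<eta> l0 (v i) t - v i)"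
    and "norm (agd a b \<eta> l0 (v i) t - v i) \<le> norm (agd a b \<eta> l0 (v i) t - wstar) + err i"
proof -
  define W where "W = norm (agd a b \<eta> l0 (v i) t - wstar)"
  define X where "X = (real t + 1) / (2 * s)"
  define \<delta> where "\<delta> = norm (agd a b \<eta> l0 (v i) t - v i)"
  have XW: "X * W \<le> err i" and quad: "(1 + X\<^sup>2 / 2) * W\<^sup>2 \<le> (err i)\<^sup>2"
    unfolding X_def W_def s_def err_def by (rule agd_distance_bounds[OF l0 assms])+
  have X: "0 \<le> X" using s_ge_1 by (simp add: X_def)
  have "W\<^sup>2 \<le> (1 + X\<^sup>2 / 2) * W\<^sup>2" by (simp add: distrib_right)
  with quad have "W\<^sup>2 \<le> (err i)\<^sup>2" by linarith
  then have W: "W \<le> err i" by (rule power2_le_imp_le) (simp add: err_def)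
  have "err i \<le> W + \<delta>"
    using norm_triangle_ineq4[of "agd a b \<eta> l0 (v i) t - wstar" "agd a b \<eta> l0 (v i) t - v i"]
    by (simp add: err_def W_def \<delta>_def)
  then have "X\<^sup>2 * W \<le> (X + 4) * \<delta>"
    using X XW quad by (intro displacement_lower_bound) (auto simp: W_def \<delta>_def)
  moreover have "\<delta> \<le> W + err i"
    using norm_triangle_ineq4[of "agd a b \<eta> l0 (v i) t - wstar" "v i - wstar"]
    by (simp add: err_def W_def \<delta>_def)
  ultimately show
    "(real t + 1) / (2 * s) * norm (agd a b \<eta> l0 (v i) t - wstar) \<le> err i"
    "norm (agd a b \<eta> l0 (v i) t - wstar) \<le> err i"
    "((real t + 1) / (2 * s))\<^sup>2 * norm (agd a b \<eta> l0 (v i) t - wstar)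
           \<le> ((real t + 1) / (2 * s) + 4) * norm (agd a b \<eta> l0 (v i) t - v i)"
    "norm (agd a b \<eta> l0 (v i) t - v i) \<le> norm (agd a b \<eta> l0 (v i) t - wstar) + err i"
    using XW W by (simp_all only: X_def W_def \<delta>_def)
qed

lemma epoch_bounds:
  assumes "i \<ge> 1" "\<tau> i \<ge> 1"
  shows "err i \<le> err (i - 1)" "len i * err i \<le> err (i - 1)"
    "err i \<le> (len i + 1 / (2 * s) + 4) * ratio i"
    "ratio i \<le> 2 * err (i - 1) / (len i + 1 / (2 * s))\<^sup>2"
proof -
  define X where "X = len i + 1 / (2 * s)"
  note bounds = agd_bounds[OF assms(2), of "i - 1", folded v_eq[OF assms(1)] len_shift X_def]
  have X: "X > 0" using s_ge_1 assms by (simp add: X_def len_shift)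
  show 1: "err i \<le> err (i - 1)" using bounds(2) by (simp add: err_def)
  have "len i * err i \<le> X * err i"
    using shift_bounds by (intro mult_right_mono) (auto simp: X_def err_def)
  also have "\<dots> \<le> err (i - 1)" using bounds(1) by (simp add: err_def)
  finally show "len i * err i \<le> err (i - 1)" .
  show "err i \<le> (len i + 1 / (2 * s) + 4) * ratio i"
    using bounds(3) X unfolding ratio_def X_def[symmetric]
    by (simp add: err_def disp_def field_simps)
  have "disp i \<le> 2 * err (i - 1)"
    using bounds(4) 1 by (simp add: err_def disp_def)
  then show "ratio i \<le> 2 * err (i - 1) / (len i + 1 / (2 * s))\<^sup>2"
    by (simp add: ratio_def divide_right_mono)
qed

text \<open>The displacement stays below twice the initial error while its denominator grows; the
  threshold is positive because the previous error is.\<close>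

lemma epoch_terminates_next:
  assumes "i \<ge> 2" "\<tau> (i - 1) \<ge> 1" "err (i - 1) > 0"
  shows "\<exists>t\<ge>1. stop_test a b \<eta> l0 (1 / 4) v \<tau> i t"
proof -
  define R where "R = err (i - 1)"
  define c where "c = ratio (i - 1) / 4"
  have "0 < len (i - 1) + 1 / (2 * s) + 4" using s_ge_1 by (simp add: len_shift add_pos_pos)
  moreover have "0 < (len (i - 1) + 1 / (2 * s) + 4) * ratio (i - 1)"
  proof -
    have "1 \<le> i - 1" using assms(1) by simp
    then show ?thesis using epoch_bounds(3) assms(2,3) by (meson less_le_trans)
  qed
  ultimately have c: "c > 0" by (simp add: c_def zero_less_mult_iff)
  obtain t :: nat where t: "2 * R * (2 * s)\<^sup>2 / c < real t" using reals_Archimedean2 by blast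
  have "0 \<le> 2 * R * (2 * s)\<^sup>2 / c" using c by (simp add: R_def err_def)
  then have t1: "t \<ge> 1" using t by linarith
  have "2 * R * (2 * s)\<^sup>2 \<le> c * real t" using t c by (simp add: field_simps)
  also have "\<dots> \<le> c * (real t + 1)\<^sup>2" using c by (simp add: power2_eq_square algebra_simps)
  finally have "2 * R / ((real t + 1) / (2 * s))\<^sup>2 \<le> c"
    using s_ge_1 by (simp add: power_divide divide_le_eq)
  moreover have "norm (agd a b \<eta> l0 (v (i - 1)) t - v (i - 1)) \<le> 2 * R"
    using agd_bounds(2,4)[OF t1, of "i - 1"] by (simp add: R_def)
  ultimately have "stop_test a b \<eta> l0 (1 / 4) v \<tau> i t"
    unfolding stop_test_iff c_def[symmetric]
    by (meson divide_right_mono order_trans zero_le_power2)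
  then show ?thesis using t1 by blast
qed

lemma epoch_length_least:
  assumes "i \<ge> 2" "\<exists>t\<ge>1. stop_test a b \<eta> l0 (1 / 4) v \<tau> i t"
  shows "\<tau> i \<ge> 1" "stop_test a b \<eta> l0 (1 / 4) v \<tau> i (\<tau> i)"
    and "\<And>t. 1 \<le> t \<Longrightarrow> t < \<tau> i \<Longrightarrow> \<not> stop_test a b \<eta> l0 (1 / 4) v \<tau> i t"
proof -
  define P where "P = (\<lambda>t. t \<ge> 1 \<and> stop_test a b \<eta> l0 (1 / 4) v \<tau> i t)"
  have \<tau>: "\<tau> i = (LEAST t. P t)" using run assms(1) by (simp add: restarted_agd_def P_def)
  have "\<exists>t. P t" using assms(2) by (auto simp: P_def)
  then have "P (\<tau> i)" unfolding \<tau> by (rule LeastI_ex)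
  then show "\<tau> i \<ge> 1" "stop_test a b \<eta> l0 (1 / 4) v \<tau> i (\<tau> i)" by (auto simp: P_def)
  show "\<not> stop_test a b \<eta> l0 (1 / 4) v \<tau> i t" if "1 \<le> t" "t < \<tau> i" for t
    using not_less_Least[of t P] that by (auto simp: \<tau> P_def)
qed

lemma ratio_decay:
  assumes "i \<ge> 2" "\<exists>t\<ge>1. stop_test a b \<eta> l0 (1 / 4) v \<tau> i t"
  shows "ratio i \<le> ratio (i - 1) / 4"
  using epoch_length_least(2)[OF assms] v_eq[of i] assms(1)
  by (simp add: stop_test_iff ratio_def disp_def len_shift)

text \<open>The test failed one step before the epoch ended.\<close>

lemma long_epoch_bound:
  assumes i: "i \<ge> 2" "\<exists>t\<ge>1. stop_test a b \<eta> l0 (1 / 4) v \<tau> i t"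
    and prev: "\<tau> (i - 1) \<ge> 1" "err (i - 1) > 0"
    and long: "len i > 8"
  shows "(len i)\<^sup>2 \<le> 9 / 2 * (len (i - 1) + 9 / 2)"
proof -
  define R where "R = err (i - 1)"
  have "16 \<le> 16 * s" using s_ge_1 by simp
  also have "\<dots> < real (\<tau> i)" using long s_ge_1 by (simp add: len_def field_simps)
  finally have \<tau>: "\<tau> i \<ge> 2" by linarith
  \<comment> \<open>As \<open>t + 1 = \<tau> i\<close>, the normalised length in the failed test is
    exactly \<open>len i\<close>, without shift.\<close>
  define t where "t = \<tau> i - 1"
  have t: "1 \<le> t" "t < \<tau> i" "(real t + 1) / (2 * s) = len i"
    using \<tau> by (auto simp: t_def len_def of_nat_diff)
  define W where "W = norm (agd a b \<eta> l0 (v (i - 1)) t - wstar)"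
  define \<delta> where "\<delta> = norm (agd a b \<eta> l0 (v (i - 1)) t - v (i - 1))"
  \<comment> \<open>Hence the displacement is at most \<open>R + R / 8\<close>; the factor 4 of the
    test makes this \<open>9 / 2 * R\<close>.\<close>
  have "8 * W \<le> len i * W" using long by (intro mult_right_mono) (auto simp: W_def)
  also have "\<dots> \<le> R" using agd_bounds(1)[OF t(1), of "i - 1"] by (simp add: W_def R_def t(3))
  finally have \<delta>: "\<delta> \<le> 9 / 8 * R"
    using agd_bounds(4)[OF t(1), of "i - 1"] by (simp add: W_def \<delta>_def R_def)
  have "ratio (i - 1) / 4 < \<delta> / (len i)\<^sup>2"
    using epoch_length_least(3)[OF i t(1,2)] by (simp add: stop_test_iff t(3) \<delta>_def)
  then have "ratio (i - 1) * (len i)\<^sup>2 < 4 * \<delta>" using long by (simp add: field_simps)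
  with \<delta> have ratio: "ratio (i - 1) * (len i)\<^sup>2 \<le> 9 / 2 * R" by linarith
  have "R \<le> (len (i - 1) + 1 / (2 * s) + 4) * ratio (i - 1)"
    unfolding R_def using epoch_bounds(3) prev i by simp
  \<comment> \<open>This other \<open>9 / 2\<close> is 4 plus the largest possible shift.\<close>
  also have "\<dots> \<le> (len (i - 1) + 9 / 2) * ratio (i - 1)"
    using shift_bounds by (intro mult_right_mono) (auto simp: ratio_def disp_def)
  finally have "R * (len i)\<^sup>2 \<le> (len (i - 1) + 9 / 2) * ratio (i - 1) * (len i)\<^sup>2"
    by (intro mult_right_mono) auto
  also have "\<dots> = (len (i - 1) + 9 / 2) * (ratio (i - 1) * (len i)\<^sup>2)" by simp
  also have "\<dots> \<le> (len (i - 1) + 9 / 2) * (9 / 2 * R)"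
    using ratio s_ge_1 by (intro mult_left_mono) (auto simp: len_def)
  finally have "(len i)\<^sup>2 * R \<le> 9 / 2 * (len (i - 1) + 9 / 2) * R" by (simp add: mult_ac)
  then show ?thesis using prev(2) by (simp add: R_def)
qed

text \<open>A positive error keeps the next threshold positive. Index 0 is left out so that a start
  at the minimizer is covered with \<open>n = 1\<close>.\<close>

lemma epochs_terminate:
  assumes pos: "\<And>j. 1 \<le> j \<Longrightarrow> j < n \<Longrightarrow> err j > 0"
  shows "1 \<le> i \<Longrightarrow> i \<le> n \<Longrightarrow>
    \<tau> i \<ge> 1 \<and> (i \<ge> 2 \<longrightarrow> (\<exists>t\<ge>1. stop_test a b \<eta> l0 (1 / 4) v \<tau> i t))"
proof (induction i)
  case (Suc i)
  show ?case
  proof (cases "i = 0")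
    case True
    then show ?thesis using run by (simp add: restarted_agd_def)
  next
    case False
    then have ex: "\<exists>t\<ge>1. stop_test a b \<eta> l0 (1 / 4) v \<tau> (Suc i) t"
      using Suc pos[of i] by (intro epoch_terminates_next) auto
    then show ?thesis using epoch_length_least(1)[of "Suc i"] False by auto
  qed
qed simp

lemma epoch_sequence:
  assumes "n \<ge> 1" and pos: "\<And>j. j < n \<Longrightarrow> err j > 0"
  shows "epoch_sequence len err ratio (1 / (2 * s)) n"
proof
  have T: "\<tau> i \<ge> 1" "i \<ge> 2 \<Longrightarrow> \<exists>t\<ge>1. stop_test a b \<eta> l0 (1 / 4) v \<tau> i t" if "i \<in> {1..n}" for i
    using epochs_terminate[of n i] pos that by auto
  show "0 < len i" if "i \<in> {1..n}" for i
    using T(1)[OF that] s_ge_1 by (simp add: len_def)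
  show "err i \<le> err (i - 1)" "len i * err i \<le> err (i - 1)"
    "err i \<le> (len i + 1 / (2 * s) + 4) * ratio i" if "i \<in> {1..n}" for i
    using epoch_bounds(1-3)[of i] T(1)[OF that] that by auto
  show "ratio 1 \<le> 2 * err 0 / (len 1 + 1 / (2 * s))\<^sup>2"
    using epoch_bounds(4)[of 1] T(1)[of 1] assms(1) by simp
  show "ratio i \<le> ratio (i - 1) / 4" if "i \<in> {2..n}" for i
    using that T(2)[of i] by (intro ratio_decay) auto
  show "(len i)\<^sup>2 \<le> 9 / 2 * (len (i - 1) + 9 / 2)" if "i \<in> {2..n}" "8 < len i" for i
  proof (rule long_epoch_bound)
    have "i - 1 \<in> {1..n}" "i - 1 < n" using that by auto
    then show "\<tau> (i - 1) \<ge> 1" "err (i - 1) > 0" using T(1) pos by blast+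
  qed (use that T(2)[of i] in auto)
qed (use assms shift_bounds in auto)

text \<open>Otherwise \<open>epoch_count\<close> would bound all powers of 4 by one
  constant.\<close>

lemma accuracy_reached:
  assumes \<epsilon>: "\<epsilon> > 0"
  shows "\<exists>n\<ge>1. err n \<le> \<epsilon> * err 0"
proof (rule ccontr)
  assume "\<not> ?thesis"
  then have large: "\<epsilon> * err 0 < err n" if "n \<ge> 1" for n using that by force
  have err_nonneg: "0 \<le> err i" for i by (simp add: err_def)
  have pos': "err n > 0" if "n \<ge> 1" for n
    using large[OF that] \<epsilon> err_nonneg[of 0] by (meson le_less_trans mult_nonneg_nonneg less_imp_le)
  have "\<tau> 1 \<ge> 1" using run by (simp add: restarted_agd_def)
  then have "err 0 > 0" using epoch_bounds(1)[of 1] pos'[of 1] by simp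
  then have pos: "err n > 0" for n using pos'[of n] by (cases "n = 0") auto
  define B where "B = 2 * (max 8 (len 1) + 9 / 2) / (len 1)\<^sup>2"
  obtain k where k: "B * (1 / \<epsilon>) < 4 ^ k" using real_arch_pow[of 4] by force
  interpret epoch_sequence len err ratio "1 / (2 * s)" "Suc k"
    by (rule epoch_sequence) (use pos in auto)
  have "4 ^ k \<le> B * (err 0 / err (Suc k))"
    using epoch_count[of "Suc k"] pos unfolding B_def by simp
  also have "\<dots> \<le> B * (1 / \<epsilon>)"
    using large[of "Suc k"] pos \<epsilon> by (intro mult_left_mono) (auto simp: B_def field_simps)
  finally show False using k by simp
qed

lemma total_steps_bound:
  assumes \<epsilon>: "0 < \<epsilon>" "\<epsilon> < 1"
  shows "\<exists>n\<ge>1. (\<forall>i\<in>{1..n}. epoch_terminates a b \<eta> l0 (1 / 4) v \<tau> i) \<and> err n \<le> \<epsilon> * err 0 \<and>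
    real (\<Sum>i=1..n. \<tau> i) \<le> 17 / 2 * s * ln (8 / \<epsilon>) + max (26 * s * ln (12 * s / real (\<tau> 1))) (2 * real (\<tau> 1))"
proof -
  define n where "n = (LEAST n. n \<ge> 1 \<and> err n \<le> \<epsilon> * err 0)"
  have n: "n \<ge> 1" "err n \<le> \<epsilon> * err 0"
    using LeastI_ex[OF accuracy_reached[OF \<epsilon>(1)]] by (auto simp: n_def)
  have large: "\<epsilon> * err 0 < err i" if "i \<ge> 1" "i < n" for i
    using not_less_Least[of i "\<lambda>n. n \<ge> 1 \<and> err n \<le> \<epsilon> * err 0"] that by (auto simp: n_def)
  have pos': "err i > 0" if "i \<ge> 1" "i < n" for i
  proof -
    have "0 \<le> \<epsilon> * err 0" using \<epsilon> by (simp add: err_def)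
    then show ?thesis using large[OF that] by linarith
  qed
  have stops: "epoch_terminates a b \<eta> l0 (1 / 4) v \<tau> i" if "i \<in> {1..n}" for i
    using epochs_terminate[of n i] pos' that by (cases "i = 1") (auto simp: epoch_terminates_def)
  have \<tau>1: "\<tau> 1 \<ge> 1" using run by (simp add: restarted_agd_def)
  have "real (\<Sum>i=1..n. \<tau> i) \<le> 17 / 2 * s * ln (8 / \<epsilon>)
      + max (26 * s * ln (12 * s / real (\<tau> 1))) (2 * real (\<tau> 1))"
  \<comment> \<open>A start at the minimizer needs a single epoch; the normalised sequence requires
    a positive initial error.\<close>
  proof (cases "err 0 = 0")
    case True
    then have "err 1 \<le> \<epsilon> * err 0" using epoch_bounds(1)[of 1] \<tau>1 by simp
    then have "n = 1" using n unfolding n_def by (metis (mono_tags, lifting) Least_le le_antisym le_refl)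
    moreover have "0 \<le> 17 / 2 * s * ln (8 / \<epsilon>)" using \<epsilon> s_ge_1 by (simp add: le_divide_eq)
    ultimately show ?thesis by (simp add: max_def)
  next
    case False
    then have "err 0 > 0" by (simp add: err_def)
    then have pos: "err i > 0" if "i < n" for i using pos'[of i] that by (cases "i = 0") auto
    interpret epoch_sequence len err ratio "1 / (2 * s)" n
      by (rule epoch_sequence[OF n(1) pos])
    have "real (\<Sum>i=1..n. \<tau> i) = s * (\<Sum>i=1..n. 2 * len i)"
      using s_ge_1 by (simp add: len_def sum_distrib_left)
    also have "\<dots> \<le> s * (17 / 2 * ln (8 / \<epsilon>) + max (26 * ln (6 / len 1)) (4 * len 1))"
      using s_ge_1 by (intro mult_left_mono sum_lengths_bound[OF \<epsilon> large]) auto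
    also have "\<dots> = 17 / 2 * s * ln (8 / \<epsilon>) + max (26 * s * ln (6 / len 1)) (4 * s * len 1)"
      using s_ge_1 by (simp add: distrib_left max_mult_distrib_left mult_ac)
    also have "6 / len 1 = 12 * s / real (\<tau> 1)" using s_ge_1 by (simp add: len_def)
    also have "4 * s * len 1 = 2 * real (\<tau> 1)" using s_ge_1 by (simp add: len_def)
    finally show ?thesis .
  qed
  then show ?thesis using n stops by blast
qed

end

theorem corollary2:
  fixes a b :: "real ^ 'p \<Rightarrow> real"
    and wstar :: "real ^ 'p"
    and \<alpha> L \<beta> \<epsilon> \<eta> l0 \<kappa> :: real
    and v :: "nat \<Rightarrow> real ^ 'p"
    and \<tau> :: "nat \<Rightarrow> nat"
  assumes "\<alpha> > 0"
    and "strongly_convex \<alpha> a"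
    and "smooth L a"
    and "continuous_on UNIV b"
    and "convex_on UNIV b"
    and "is_arg_min (\<lambda>w. a w + b w) (\<lambda>_. True) wstar"
    and "\<beta> = 1 / 4"
    and "0 < \<epsilon>" and "\<epsilon> < 1"
    and "\<eta> > 1"
    and "0 < l0" and "l0 \<le> L"
    and "\<kappa> = L * \<eta> / \<alpha>"
    and "restarted_agd a b \<eta> l0 \<beta> v \<tau>"
  shows "\<exists>n\<ge>1.
           (\<forall>i\<in>{1..n}. epoch_terminates a b \<eta> l0 \<beta> v \<tau> i) \<and>
           norm (wstar - v n) \<le> \<epsilon> * norm (wstar - v 0) \<and>
           real (\<Sum>i=1..n. \<tau> i)
             \<le> 8.5 * (sqrt \<kappa> + 1) * ln (8 / \<epsilon>)
               + max (26 * sqrt \<kappa> * ln (12 * sqrt \<kappa> / real (\<tau> 1))) (2 * real (\<tau> 1))"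
proof -
  have "restarted_agd a b \<eta> l0 (1 / 4) v \<tau>"
    using assms(14) unfolding assms(7) .
  \<comment> \<open>The eigenvalue and Lipschitz conditions enter as the two quadratic
    bounds.\<close>
  then interpret restarted_problem a b wstar \<alpha> L \<eta> \<kappa> l0 v \<tau>
    using assms strongly_convex_lower_bound[OF assms(2)] smooth_upper_bound[OF assms(3)]
    by unfold_locales (simp_all add: is_arg_min_linorder)
  obtain n where "n \<ge> 1" "\<forall>i\<in>{1..n}. epoch_terminates a b \<eta> l0 \<beta> v \<tau> i"
    and err: "err n \<le> \<epsilon> * err 0"
    and sum: "real (\<Sum>i=1..n. \<tau> i) \<le> 17 / 2 * s * ln (8 / \<epsilon>)
      + max (26 * s * ln (12 * s / real (\<tau> 1))) (2 * real (\<tau> 1))"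
    using total_steps_bound[OF assms(8,9)] assms(7) by blast
  moreover have "0 \<le> ln (8 / \<epsilon>)" using assms(8,9) by (simp add: le_divide_eq)
  then have "17 / 2 * s * ln (8 / \<epsilon>) \<le> 8.5 * (sqrt \<kappa> + 1) * ln (8 / \<epsilon>)"
    by (simp add: s_def algebra_simps)
  with sum have "real (\<Sum>i=1..n. \<tau> i) \<le> 8.5 * (sqrt \<kappa> + 1) * ln (8 / \<epsilon>)
      + max (26 * sqrt \<kappa> * ln (12 * sqrt \<kappa> / real (\<tau> 1))) (2 * real (\<tau> 1))"
    unfolding s_def by linarith
  moreover have "norm (wstar - v n) \<le> \<epsilon> * norm (wstar - v 0)"
    using err by (simp add: err_def norm_minus_commute)
  ultimately show ?thesis by blast
qed

end
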